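(* Let $A$ be a pseudo-contractible Banach algebra. Then $A$ is strong pseudo-amenable.
   Context: For a (complex) Banach algebra $A$, $A\otimes_p A$ is the projective tensor product, a Banach $A$-bimodule via $a\cdot(b\otimes c)=ab\otimes c$, $(b\otimes c)\cdot a=b\otimes ca$; $\pi_A:A\otimes_pA\to A$ is the bounded linear map with $\pi_A(a\otimes b)=ab$. For a Banach $A$-bimodule $X$, $X^*$ is a Banach $A$-bimodule via $(a\cdot f)(x)=f(x\cdot a)$, $(f\cdot a)(x)=f(a\cdot x)$; iterating, $(A\otimes_pA)^{**}$ and $A^{**}$ are Banach $A$-bimodules, and $A\subseteq A^{**}$ canonically. $A$ is strong pseudo-amenable if there is a (not necessarily bounded) net $(m_\alpha)$ in $(A\otimes_pA)^{**}$ such that for every $a\in A$: $a\cdot m_\alpha-m_\alpha\cdot a\to 0$ in norm, $a\,\pi_A^{**}(m_\alpha)=\pi_A^{**}(m_\alpha)\,a$ for all $\alpha$, and $\pi_A^{**}(m_\alpha)\,a\to a$ in norm. $A$ is pseudo-contractible if there is a (not necessarily bounded) net $(m_\alpha)$ in $A\otimes_pA$ with $a\cdot m_\alpha=m_\alpha\cdot a$ for all $\alpha$ and $\pi_A(m_\alpha)a\to a$ in norm, for every $a\in A$. *)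

theory Defs
  imports "HOL-Analysis.Analysis"
begin

section \<open>Complex Banach spaces and Banach algebras\<close>

class complex_vector = real_vector +
  fixes scaleC :: "complex \<Rightarrow> 'a \<Rightarrow> 'a"  (infixr "*\<^sub>C" 75)
  assumes scaleC_add_right: "c *\<^sub>C (x + y) = c *\<^sub>C x + c *\<^sub>C y"
    and scaleC_add_left: "(c + d) *\<^sub>C x = c *\<^sub>C x + d *\<^sub>C x"
    and scaleC_scaleC: "c *\<^sub>C d *\<^sub>C x = (c * d) *\<^sub>C x"
    and scaleR_scaleC: "r *\<^sub>R x = complex_of_real r *\<^sub>C x"

class complex_normed_vector = complex_vector + real_normed_vector +
  assumes norm_scaleC: "norm (c *\<^sub>C x) = cmod c * norm x"

class complex_banach = complex_normed_vector + complete_space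

text \<open>No unit is assumed.\<close>
class complex_banach_algebra = complex_banach + real_normed_algebra +
  assumes mult_scaleC_left: "(c *\<^sub>C x) * y = c *\<^sub>C (x * y)"
    and mult_scaleC_right: "x * (c *\<^sub>C y) = c *\<^sub>C (x * y)"

subclass (in complex_banach) banach ..

instantiation complex :: complex_banach_algebra
begin
definition scaleC_complex :: "complex \<Rightarrow> complex \<Rightarrow> complex" where
  "scaleC_complex c x = c * x"
instance
  by standard (auto simp: scaleC_complex_def algebra_simps norm_mult scaleR_conv_of_real)
end

definition bounded_clinear :: "('a::complex_normed_vector \<Rightarrow> 'b::complex_normed_vector) \<Rightarrow> bool" where
  "bounded_clinear f \<longleftrightarrow> bounded_linear f \<and> (\<forall>c x. f (c *\<^sub>C x) = c *\<^sub>C f x)"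

definition bounded_cbilinear ::
  "('a::complex_normed_vector \<Rightarrow> 'b::complex_normed_vector \<Rightarrow> 'c::complex_normed_vector) \<Rightarrow> bool" where
  "bounded_cbilinear h \<longleftrightarrow> bounded_bilinear h \<and>
     (\<forall>c x y. h (c *\<^sub>C x) y = c *\<^sub>C h x y \<and> h x (c *\<^sub>C y) = c *\<^sub>C h x y)"

lemma scaleC_one [simp]: "1 *\<^sub>C (x::'a::complex_vector) = x"
  using scaleR_scaleC[of 1 x] by simp

lemma bounded_clinear_compose:
  "bounded_clinear f \<Longrightarrow> bounded_clinear g \<Longrightarrow> bounded_clinear (\<lambda>x. f (g x))"
  by (simp add: bounded_clinear_def bounded_linear_compose)

lemma bounded_cbilinear_left: "bounded_cbilinear h \<Longrightarrow> bounded_clinear (\<lambda>x. h x y)"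
  by (simp add: bounded_clinear_def bounded_cbilinear_def bounded_bilinear.bounded_linear_left)

lemma bounded_cbilinear_right: "bounded_cbilinear h \<Longrightarrow> bounded_clinear (\<lambda>y. h x y)"
  by (simp add: bounded_clinear_def bounded_cbilinear_def bounded_bilinear.bounded_linear_right)

lemma bounded_cbilinear_mult:
  "bounded_cbilinear ((*) :: 'a::complex_banach_algebra \<Rightarrow> 'a \<Rightarrow> 'a)"
  by (simp add: bounded_cbilinear_def bounded_bilinear_mult mult_scaleC_left mult_scaleC_right)


section \<open>The dual of a complex normed space\<close>

typedef (overloaded) 'a cdual =
  "{f :: 'a::complex_normed_vector \<Rightarrow>\<^sub>L complex.
      \<forall>c x. blinfun_apply f (c *\<^sub>C x) = c * blinfun_apply f x}"
  by (rule exI[of _ 0]) simp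

setup_lifting type_definition_cdual

lift_definition cdual_apply :: "'a::complex_normed_vector cdual \<Rightarrow> 'a \<Rightarrow> complex"
  is blinfun_apply .

text \<open>The norm below is the operator norm inherited from \<^typ>\<open>'a \<Rightarrow>\<^sub>L complex\<close>.\<close>

instantiation cdual :: (complex_normed_vector) complex_normed_vector
begin
lift_definition zero_cdual :: "'a cdual" is 0 by simp
lift_definition plus_cdual :: "'a cdual \<Rightarrow> 'a cdual \<Rightarrow> 'a cdual" is "(+)"
  by (simp add: blinfun.add_left algebra_simps)
lift_definition minus_cdual :: "'a cdual \<Rightarrow> 'a cdual \<Rightarrow> 'a cdual" is "(-)"
  by (simp add: blinfun.diff_left algebra_simps)
lift_definition uminus_cdual :: "'a cdual \<Rightarrow> 'a cdual" is uminus
  by (simp add: blinfun.minus_left)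
lift_definition scaleR_cdual :: "real \<Rightarrow> 'a cdual \<Rightarrow> 'a cdual" is "scaleR"
  by (simp add: blinfun.scaleR_left)
lift_definition scaleC_cdual :: "complex \<Rightarrow> 'a cdual \<Rightarrow> 'a cdual"
  is "\<lambda>c f. blinfun_compose (blinfun_mult_right c) f"
  by simp
lift_definition norm_cdual :: "'a cdual \<Rightarrow> real" is norm .
definition dist_cdual :: "'a cdual \<Rightarrow> 'a cdual \<Rightarrow> real" where
  "dist_cdual f g = norm (f - g)"
definition sgn_cdual :: "'a cdual \<Rightarrow> 'a cdual" where
  "sgn_cdual f = inverse (norm f) *\<^sub>R f"
definition uniformity_cdual :: "('a cdual \<times> 'a cdual) filter" where
  "uniformity_cdual = (INF e\<in>{0<..}. principal {(x, y). dist x y < e})"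
definition open_cdual :: "'a cdual set \<Rightarrow> bool" where
  "open_cdual U = (\<forall>x\<in>U. eventually (\<lambda>(x', y). x' = x \<longrightarrow> y \<in> U) uniformity)"

instance
proof
  fix f g :: "'a cdual" and c d :: complex and r :: real
  show "c *\<^sub>C (f + g) = c *\<^sub>C f + c *\<^sub>C g"
    by transfer (auto intro!: blinfun_eqI simp: blinfun.add_left algebra_simps)
  show "(c + d) *\<^sub>C f = c *\<^sub>C f + d *\<^sub>C f"
    by transfer (auto intro!: blinfun_eqI simp: blinfun.add_left algebra_simps)
  show "c *\<^sub>C d *\<^sub>C f = (c * d) *\<^sub>C f"
    by transfer (auto intro!: blinfun_eqI)
  show "r *\<^sub>R f = complex_of_real r *\<^sub>C f"
    by transfer (auto intro!: blinfun_eqI simp: blinfun.scaleR_left scaleR_conv_of_real)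
  show "norm (c *\<^sub>C f) = cmod c * norm f"
  proof (transfer)
    fix c :: complex and f :: "'a \<Rightarrow>\<^sub>L complex"
    have *: "norm (blinfun_compose (blinfun_mult_right c) f) \<le> cmod c * norm f" for c f
      by (rule norm_blinfun_bound)
        (auto simp: norm_mult mult.assoc intro!: mult_left_mono norm_blinfun)
    show "norm (blinfun_compose (blinfun_mult_right c) f) = cmod c * norm f"
    proof (cases "c = 0")
      case False
      have "blinfun_compose (blinfun_mult_right (inverse c))
             (blinfun_compose (blinfun_mult_right c) f) = f"
        using False by (auto intro!: blinfun_eqI)
      then have "norm f \<le> inverse (cmod c) * norm (blinfun_compose (blinfun_mult_right c) f)"
        using *[of "inverse c" "blinfun_compose (blinfun_mult_right c) f"]
        by (simp add: norm_inverse)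
      then have "cmod c * norm f \<le> norm (blinfun_compose (blinfun_mult_right c) f)"
        using False by (simp add: field_simps)
      then show ?thesis using * [of c f] by linarith
    qed (use *[of c f] in auto)
  qed
qed (transfer; simp add: algebra_simps norm_triangle_ineq
      dist_cdual_def sgn_cdual_def uniformity_cdual_def open_cdual_def; fail
     | simp add: dist_cdual_def sgn_cdual_def uniformity_cdual_def open_cdual_def)+
end

lemma cdual_eqI: "(\<And>x. cdual_apply f x = cdual_apply g x) \<Longrightarrow> f = g"
  by transfer (rule blinfun_eqI)

lemma cdual_apply_simps:
  "cdual_apply 0 x = 0"
  "cdual_apply (f + g) x = cdual_apply f x + cdual_apply g x"
  "cdual_apply (f - g) x = cdual_apply f x - cdual_apply g x"
  "cdual_apply (- f) x = - cdual_apply f x"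
  "cdual_apply (r *\<^sub>R f) x = r *\<^sub>R cdual_apply f x"
  "cdual_apply (c *\<^sub>C f) x = c * cdual_apply f x"
  by (transfer; simp add: blinfun.bilinear_simps)+

lemma norm_cdual_apply: "norm (cdual_apply f x) \<le> norm f * norm x"
  by transfer (rule norm_blinfun)

lemma norm_cdual_bound:
  "0 \<le> b \<Longrightarrow> (\<And>x. norm (cdual_apply f x) \<le> b * norm x) \<Longrightarrow> norm f \<le> b"
  by transfer (rule norm_blinfun_bound)

lemma bounded_clinear_cdual_apply: "bounded_clinear (cdual_apply f)"
  unfolding bounded_clinear_def scaleC_complex_def
  by transfer (auto intro: blinfun.bounded_linear_right)

lemma norm_cdual_eq_onorm: "norm f = onorm (cdual_apply f)"
  by transfer (rule norm_blinfun.rep_eq)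

lemma bounded_cbilinear_cdual_apply:
  "bounded_cbilinear (cdual_apply :: 'a::complex_normed_vector cdual \<Rightarrow> _)"
proof -
  have "bounded_bilinear (cdual_apply :: 'a cdual \<Rightarrow> _)"
  proof
    fix f :: "'a cdual" and x y r
    interpret f: bounded_linear "cdual_apply f"
      using bounded_clinear_cdual_apply bounded_clinear_def by blast
    show "cdual_apply f (x + y) = cdual_apply f x + cdual_apply f y"
      by (rule f.add)
    show "cdual_apply f (r *\<^sub>R x) = r *\<^sub>R cdual_apply f x"
      by (rule f.scaleR)
    show "\<exists>K. \<forall>(f::'a cdual) x. norm (cdual_apply f x) \<le> norm f * norm x * K"
      by (rule exI[of _ 1]) (simp add: norm_cdual_apply)
  qed (simp_all add: cdual_apply_simps)
  then show ?thesis
    using bounded_clinear_cdual_apply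
    by (auto simp: bounded_cbilinear_def bounded_clinear_def cdual_apply_simps scaleC_complex_def)
qed

instance cdual :: (complex_normed_vector) complex_banach
proof
  fix X :: "nat \<Rightarrow> 'a cdual"
  assume X: "Cauchy X"
  have d: "dist (Rep_cdual f) (Rep_cdual g) = dist f g" for f g :: "'a cdual"
    by (simp add: dist_norm norm_cdual.rep_eq minus_cdual.rep_eq)
  have "Cauchy (\<lambda>n. Rep_cdual (X n))"
    using X by (simp add: Cauchy_def d)
  then obtain L where L: "(\<lambda>n. Rep_cdual (X n)) \<longlonglongrightarrow> L"
    using convergent_eq_Cauchy by blast
  have "blinfun_apply L (c *\<^sub>C x) = c * blinfun_apply L x" for c x
  proof (rule LIMSEQ_unique)
    show "(\<lambda>n. blinfun_apply (Rep_cdual (X n)) (c *\<^sub>C x)) \<longlonglongrightarrow> blinfun_apply L (c *\<^sub>C x)"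
      by (intro tendsto_intros L)
    have "(\<lambda>n. c * blinfun_apply (Rep_cdual (X n)) x) \<longlonglongrightarrow> c * blinfun_apply L x"
      by (intro tendsto_intros L)
    moreover have "blinfun_apply (Rep_cdual (X n)) (c *\<^sub>C x) = c * blinfun_apply (Rep_cdual (X n)) x" for n
      using Rep_cdual[of "X n"] by simp
    ultimately show "(\<lambda>n. blinfun_apply (Rep_cdual (X n)) (c *\<^sub>C x)) \<longlonglongrightarrow> c * blinfun_apply L x"
      by simp
  qed
  then have M: "Rep_cdual (Abs_cdual L) = L"
    by (simp add: Abs_cdual_inverse)
  have "X \<longlonglongrightarrow> Abs_cdual L"
    using L by (simp add: M tendsto_iff d[symmetric])
  then show "convergent X"
    by (auto simp: convergent_def)
qed

definition to_cdual :: "('a::complex_normed_vector \<Rightarrow> complex) \<Rightarrow> 'a cdual" where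
  "to_cdual f = Abs_cdual (Blinfun f)"

lemma cdual_apply_to_cdual:
  assumes "bounded_clinear f"
  shows "cdual_apply (to_cdual f) = f"
proof -
  have "bounded_linear f" "\<And>c x. f (c *\<^sub>C x) = c * f x"
    using assms by (auto simp: bounded_clinear_def scaleC_complex_def)
  then show ?thesis
    unfolding to_cdual_def cdual_apply.rep_eq
    by (subst Abs_cdual_inverse) (auto simp: bounded_linear_Blinfun_apply)
qed

definition adjoint_map ::
  "('a::complex_normed_vector \<Rightarrow> 'b::complex_normed_vector) \<Rightarrow> 'b cdual \<Rightarrow> 'a cdual" where
  "adjoint_map T f = to_cdual (\<lambda>x. cdual_apply f (T x))"

definition canonical_embedding :: "'a::complex_normed_vector \<Rightarrow> 'a cdual cdual" where
  "canonical_embedding x = to_cdual (\<lambda>f. cdual_apply f x)"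

lemma adjoint_map_apply:
  "bounded_clinear T \<Longrightarrow> cdual_apply (adjoint_map T f) x = cdual_apply f (T x)"
  unfolding adjoint_map_def
  by (subst cdual_apply_to_cdual)
    (simp_all add: bounded_clinear_compose[OF bounded_clinear_cdual_apply])

lemma canonical_embedding_apply:
  "cdual_apply (canonical_embedding x) f = cdual_apply f x"
  unfolding canonical_embedding_def
  by (subst cdual_apply_to_cdual)
    (simp_all add: bounded_cbilinear_left[OF bounded_cbilinear_cdual_apply])

lemma bounded_clinear_adjoint_map:
  assumes T: "bounded_clinear T"
  shows "bounded_clinear (adjoint_map T)"
proof -
  obtain K where K: "0 \<le> K" "\<And>x. norm (T x) \<le> norm x * K"
    using T bounded_linear.nonneg_bounded unfolding bounded_clinear_def by blast
  have "norm (adjoint_map T f) \<le> norm f * K" for f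
  proof (rule norm_cdual_bound)
    fix x
    have "norm (cdual_apply (adjoint_map T f) x) \<le> norm f * norm (T x)"
      by (simp add: adjoint_map_apply[OF T] norm_cdual_apply)
    also have "\<dots> \<le> norm f * (norm x * K)"
      by (intro mult_left_mono K) simp
    finally show "norm (cdual_apply (adjoint_map T f) x) \<le> norm f * K * norm x"
      by (simp add: mult_ac)
  qed (use K in simp)
  then have "bounded_linear (adjoint_map T)"
    by (intro bounded_linear_intro[of _ K])
      (auto intro!: cdual_eqI simp: adjoint_map_apply[OF T] cdual_apply_simps)
  then show ?thesis
    by (auto simp: bounded_clinear_def adjoint_map_apply[OF T] cdual_apply_simps intro!: cdual_eqI)
qed


section \<open>The algebraic tensor product\<close>

text \<open>
  The list \<open>[(a\<^sub>1, b\<^sub>1), \<dots>, (a\<^sub>n, b\<^sub>n)]\<close> stands for the formal sum of the \<open>a\<^sub>i \<otimes> b\<^sub>i\<close>, and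
  \<open>tensor_eq\<close> is the congruence generated by the bilinearity relations.  No scalar
  coefficients are needed, because \<open>c (a \<otimes> b) = (c a) \<otimes> b\<close>.
\<close>

inductive tensor_eq ::
  "('a::complex_vector \<times> 'b::complex_vector) list \<Rightarrow> ('a \<times> 'b) list \<Rightarrow> bool" where
  te_refl: "tensor_eq u u"
| te_sym: "tensor_eq u v \<Longrightarrow> tensor_eq v u"
| te_trans: "tensor_eq u v \<Longrightarrow> tensor_eq v w \<Longrightarrow> tensor_eq u w"
| te_append: "tensor_eq u u' \<Longrightarrow> tensor_eq v v' \<Longrightarrow> tensor_eq (u @ v) (u' @ v')"
| te_commute: "tensor_eq (u @ v) (v @ u)"
| te_zero: "tensor_eq [(0, b)] []"
| te_add_left: "tensor_eq [(a + a', b)] [(a, b), (a', b)]"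
| te_add_right: "tensor_eq [(a, b + b')] [(a, b), (a, b')]"
| te_scale: "tensor_eq [(c *\<^sub>C a, b)] [(a, c *\<^sub>C b)]"

quotient_type (overloaded) ('a, 'b) atensor =
    "('a::complex_vector \<times> 'b::complex_vector) list" / tensor_eq
  by (rule equivpI) (auto intro!: reflpI sympI transpI intro: tensor_eq.intros)

lemma scaleC_zero_right [simp]: "c *\<^sub>C (0::'a::complex_vector) = 0"
  using scaleC_add_right[of c 0 0] by simp

lemma scaleC_zero_left [simp]: "0 *\<^sub>C (x::'a::complex_vector) = 0"
  using scaleC_add_left[of 0 0 x] by simp

lemma scaleC_minus_one: "(-1) *\<^sub>C (x::'a::complex_vector) = - x"
  using scaleR_scaleC[of "-1" x] by simp

lemma tensor_eq_map_scaleC: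
  "tensor_eq u v \<Longrightarrow> tensor_eq (map (\<lambda>(a, b). (c *\<^sub>C a, b)) u) (map (\<lambda>(a, b). (c *\<^sub>C a, b)) v)"
proof (induction rule: tensor_eq.induct)
  case (te_scale d a b)
  have "c *\<^sub>C d *\<^sub>C a = d *\<^sub>C c *\<^sub>C a"
    by (simp add: scaleC_scaleC mult.commute)
  then show ?case
    using tensor_eq.te_scale[of d "c *\<^sub>C a" b] by simp
qed (auto simp: scaleC_add_right intro: tensor_eq.intros)

lemma te_minus: "tensor_eq (map (\<lambda>(a, b). (- a, b)) u @ u) []"
proof (induction u)
  case (Cons p u)
  obtain a b where p: "p = (a, b)"
    by fastforce
  have "tensor_eq ([(- a, b)] @ (map (\<lambda>(a, b). (- a, b)) u @ [(a, b)]) @ u)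
          ([(- a, b)] @ ([(a, b)] @ map (\<lambda>(a, b). (- a, b)) u) @ u)"
    by (intro te_append te_refl te_commute)
  moreover have "tensor_eq ([(- a, b), (a, b)] @ (map (\<lambda>(a, b). (- a, b)) u @ u)) ([] @ [])"
    by (intro te_append Cons.IH te_trans[OF te_sym[OF te_add_left]]) (simp add: te_zero)
  ultimately show ?case
    by (auto simp: p intro: te_trans)
qed (simp add: te_refl)

instantiation atensor :: (complex_vector, complex_vector) complex_vector
begin
lift_definition zero_atensor :: "('a, 'b) atensor" is "[]" .
lift_definition plus_atensor :: "('a, 'b) atensor \<Rightarrow> ('a, 'b) atensor \<Rightarrow> ('a, 'b) atensor"
  is "(@)" by (rule te_append)
lift_definition scaleC_atensor :: "complex \<Rightarrow> ('a, 'b) atensor \<Rightarrow> ('a, 'b) atensor"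
  is "\<lambda>c. map (\<lambda>(a, b). (c *\<^sub>C a, b))" by (rule tensor_eq_map_scaleC)
definition scaleR_atensor :: "real \<Rightarrow> ('a, 'b) atensor \<Rightarrow> ('a, 'b) atensor" where
  "scaleR_atensor r t = complex_of_real r *\<^sub>C t"
definition uminus_atensor :: "('a, 'b) atensor \<Rightarrow> ('a, 'b) atensor" where
  "uminus_atensor t = (-1) *\<^sub>C t"
definition minus_atensor :: "('a, 'b) atensor \<Rightarrow> ('a, 'b) atensor \<Rightarrow> ('a, 'b) atensor" where
  "minus_atensor s t = s + (-1) *\<^sub>C t"

instance
proof
  fix s t u :: "('a, 'b) atensor" and c d :: complex and r q :: real
  show "s + t + u = s + (t + u)"
    by transfer (simp add: te_refl)
  show "s + t = t + s"
    by transfer (rule te_commute)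
  show "0 + t = t"
    by transfer (simp add: te_refl)
  show "- t + t = 0"
    unfolding uminus_atensor_def by transfer (simp add: scaleC_minus_one te_minus)
  show "s - t = s + - t"
    by (simp add: minus_atensor_def uminus_atensor_def)
  show C1: "c *\<^sub>C (s + t) = c *\<^sub>C s + c *\<^sub>C t" for c and s t :: "('a, 'b) atensor"
    by transfer (simp add: te_refl)
  show C2: "(c + d) *\<^sub>C t = c *\<^sub>C t + d *\<^sub>C t" for c d and t :: "('a, 'b) atensor"
  proof transfer
    fix c d :: complex and u :: "('a \<times> 'b) list"
    show "tensor_eq (map (\<lambda>(a, b). ((c + d) *\<^sub>C a, b)) u)
            (map (\<lambda>(a, b). (c *\<^sub>C a, b)) u @ map (\<lambda>(a, b). (d *\<^sub>C a, b)) u)"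
    proof (induction u)
      case (Cons p u)
      obtain a b where p: "p = (a, b)"
        by fastforce
      let ?C = "map (\<lambda>(a, b). (c *\<^sub>C a, b)) u" and ?D = "map (\<lambda>(a, b). (d *\<^sub>C a, b)) u"
      have "tensor_eq ([((c + d) *\<^sub>C a, b)] @ map (\<lambda>(a, b). ((c + d) *\<^sub>C a, b)) u)
              ([(c *\<^sub>C a, b), (d *\<^sub>C a, b)] @ (?C @ ?D))"
        by (intro te_append Cons.IH) (simp add: scaleC_add_left te_add_left)
      moreover have "tensor_eq ([(c *\<^sub>C a, b)] @ ([(d *\<^sub>C a, b)] @ ?C) @ ?D)
              ([(c *\<^sub>C a, b)] @ (?C @ [(d *\<^sub>C a, b)]) @ ?D)"
        by (intro te_append te_refl te_commute)
      ultimately show ?case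
        by (auto simp: p intro: te_trans)
    qed (simp add: te_refl)
  qed
  show C3: "c *\<^sub>C d *\<^sub>C t = (c * d) *\<^sub>C t" for c d and t :: "('a, 'b) atensor"
    by transfer (auto simp: scaleC_scaleC comp_def case_prod_unfold te_refl)
  have C4: "1 *\<^sub>C t = t" for t :: "('a, 'b) atensor"
    by transfer (auto simp: te_refl case_prod_unfold)
  show "r *\<^sub>R t = complex_of_real r *\<^sub>C t"
    by (simp add: scaleR_atensor_def)
  show "r *\<^sub>R (s + t) = r *\<^sub>R s + r *\<^sub>R t"
    by (simp add: scaleR_atensor_def C1)
  show "(r + q) *\<^sub>R t = r *\<^sub>R t + q *\<^sub>R t"
    by (simp add: scaleR_atensor_def C2)
  show "r *\<^sub>R q *\<^sub>R t = (r * q) *\<^sub>R t"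
    by (simp add: scaleR_atensor_def C3)
  show "1 *\<^sub>R t = t"
    by (simp add: scaleR_atensor_def C4)
qed
end

definition list_weight ::
  "('a::real_normed_vector \<times> 'b::real_normed_vector) list \<Rightarrow> real" where
  "list_weight u = (\<Sum>(a, b)\<leftarrow>u. norm a * norm b)"

definition projective_norm ::
  "('a::complex_normed_vector, 'b::complex_normed_vector) atensor \<Rightarrow> real" where
  "projective_norm t = Inf {list_weight u | u. abs_atensor u = t}"

lemma list_weight_simps [simp]:
  "list_weight [] = 0"
  "list_weight ((a, b) # u) = norm a * norm b + list_weight u"
  "list_weight (u @ v) = list_weight u + list_weight v"
  by (simp_all add: list_weight_def)

lemma list_weight_nonneg [simp]: "0 \<le> list_weight u"
  by (induction u) auto

lemma list_weight_scaleC: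
  "list_weight (map (\<lambda>(a, b). (c *\<^sub>C a, b)) u) = cmod c * list_weight u"
  for u :: "('a::complex_normed_vector \<times> 'b::complex_normed_vector) list"
  by (induction u) (auto simp: norm_scaleC algebra_simps)

lemma projective_norm_le: "projective_norm (abs_atensor u) \<le> list_weight u"
  unfolding projective_norm_def
  by (rule cInf_lower) (auto intro: bdd_belowI[of _ 0])

lemma projective_norm_greatest:
  "(\<And>u. abs_atensor u = t \<Longrightarrow> z \<le> list_weight u) \<Longrightarrow> z \<le> projective_norm t"
  unfolding projective_norm_def
  by (rule cInf_greatest) (use Quotient3_abs_rep[OF Quotient3_atensor] in blast)+

lemma projective_norm_nonneg [simp]: "0 \<le> projective_norm t"
  by (rule projective_norm_greatest) simp

lemma projective_norm_zero [simp]: "projective_norm 0 = 0"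
  using projective_norm_le[of "[]"]
  by (intro antisym) (simp_all add: zero_atensor.abs_eq[symmetric])

lemma projective_norm_approx:
  assumes "0 < e"
  obtains u where "abs_atensor u = t" "list_weight u < projective_norm t + e"
proof -
  have "\<not> (\<forall>u. abs_atensor u = t \<longrightarrow> projective_norm t + e \<le> list_weight u)"
    using projective_norm_greatest[of t "projective_norm t + e"] assms by fastforce
  then show ?thesis
    using that by (auto simp: not_le)
qed

lemma projective_norm_triangle:
  "projective_norm (s + t) \<le> projective_norm s + projective_norm t"
proof (rule field_le_epsilon)
  fix e :: real assume e: "0 < e"
  obtain u where u: "abs_atensor u = s" "list_weight u < projective_norm s + e / 2"
    using projective_norm_approx[of "e / 2"] e by auto
  obtain v where v: "abs_atensor v = t" "list_weight v < projective_norm t + e / 2"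
    using projective_norm_approx[of "e / 2"] e by auto
  have "s + t = abs_atensor (u @ v)"
    using u v plus_atensor.abs_eq by metis
  then have "projective_norm (s + t) \<le> list_weight u + list_weight v"
    using projective_norm_le[of "u @ v"] by simp
  then show "projective_norm (s + t) \<le> projective_norm s + projective_norm t + e"
    using u v by linarith
qed

lemma projective_norm_scaleC: "projective_norm (c *\<^sub>C t) = cmod c * projective_norm t"
proof -
  have le: "projective_norm (c *\<^sub>C t) \<le> cmod c * projective_norm t"
    if "c \<noteq> 0" for c and t :: "('a, 'b) atensor"
  proof -
    have "projective_norm (c *\<^sub>C t) / cmod c \<le> projective_norm t"
    proof (rule projective_norm_greatest)
      fix u assume "abs_atensor u = t"
      then have "projective_norm (c *\<^sub>C t) \<le> cmod c * list_weight u"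
        using projective_norm_le[of "map (\<lambda>(a, b). (c *\<^sub>C a, b)) u"]
        by (metis scaleC_atensor.abs_eq list_weight_scaleC)
      then show "projective_norm (c *\<^sub>C t) / cmod c \<le> list_weight u"
        using that by (simp add: field_simps)
    qed
    then show ?thesis
      using that by (simp add: field_simps)
  qed
  show ?thesis
  proof (cases "c = 0")
    case False
    have "projective_norm (inverse c *\<^sub>C c *\<^sub>C t) \<le> cmod (inverse c) * projective_norm (c *\<^sub>C t)"
      using False by (intro le) simp
    then have "cmod c * projective_norm t \<le> projective_norm (c *\<^sub>C t)"
      using False by (simp add: scaleC_scaleC norm_divide field_simps)
    then show ?thesis
      using le[OF False, of t] by linarith
  qed simp
qed

lemma scaleC_minus_right: "c *\<^sub>C (- x) = - (c *\<^sub>C (x::'a::complex_vector))"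
  using scaleC_scaleC[of c "-1" x] scaleC_scaleC[of "-1" c x] by (simp add: scaleC_minus_one)

lemma scaleC_diff_right: "c *\<^sub>C (x - y) = c *\<^sub>C x - c *\<^sub>C (y::'a::complex_vector)"
  using scaleC_add_right[of c x "- y"] by (simp add: scaleC_minus_right)

lemma projective_norm_minus: "projective_norm (- t) = projective_norm t"
  using projective_norm_scaleC[of "-1" t] by (simp add: scaleC_minus_one)

lemma projective_norm_minus_commute: "projective_norm (s - t) = projective_norm (t - s)"
  using projective_norm_minus[of "s - t"] by simp

lemma projective_norm_triangle_diff:
  "projective_norm (s - u) \<le> projective_norm (s - t) + projective_norm (t - u)"
  using projective_norm_triangle[of "s - t" "t - u"] by simp

lemma projective_norm_reverse:
  "\<bar>projective_norm s - projective_norm t\<bar> \<le> projective_norm (s - t)"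
  using projective_norm_triangle[of "s - t" t] projective_norm_triangle[of "t - s" s]
  by (simp add: projective_norm_minus_commute)


section \<open>The projective tensor product\<close>

definition pt_Cauchy ::
  "(nat \<Rightarrow> ('a::complex_normed_vector, 'b::complex_normed_vector) atensor) \<Rightarrow> bool" where
  "pt_Cauchy X \<longleftrightarrow> (\<forall>e>0. \<exists>N. \<forall>m\<ge>N. \<forall>n\<ge>N. projective_norm (X m - X n) < e)"

definition pt_eq ::
  "(nat \<Rightarrow> ('a::complex_normed_vector, 'b::complex_normed_vector) atensor) \<Rightarrow>
   (nat \<Rightarrow> ('a, 'b) atensor) \<Rightarrow> bool" where
  "pt_eq X Y \<longleftrightarrow> pt_Cauchy X \<and> pt_Cauchy Y \<and> (\<lambda>n. projective_norm (X n - Y n)) \<longlonglongrightarrow> 0"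

lemma pt_tendsto_zero_le:
  "(\<And>n. projective_norm (X n) \<le> f n) \<Longrightarrow> f \<longlonglongrightarrow> (0::real) \<Longrightarrow>
     (\<lambda>n. projective_norm (X n)) \<longlonglongrightarrow> 0"
  by (rule tendsto_sandwich[of "\<lambda>_. 0" _ _ f]) auto

lemma part_equivp_pt_eq:
  "part_equivp (pt_eq ::
     (nat \<Rightarrow> ('a::complex_normed_vector, 'b::complex_normed_vector) atensor) \<Rightarrow> _)"
proof (rule part_equivpI)
  show "\<exists>X :: nat \<Rightarrow> ('a, 'b) atensor. pt_eq X X"
    by (rule exI[of _ "\<lambda>_. 0"]) (auto simp: pt_eq_def pt_Cauchy_def)
  show "symp (pt_eq :: (nat \<Rightarrow> ('a, 'b) atensor) \<Rightarrow> _)"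
    by (rule sympI) (simp add: pt_eq_def projective_norm_minus_commute)
  show "transp (pt_eq :: (nat \<Rightarrow> ('a, 'b) atensor) \<Rightarrow> _)"
  proof (rule transpI)
    fix X Y Z :: "nat \<Rightarrow> ('a, 'b) atensor"
    assume XY: "pt_eq X Y" and YZ: "pt_eq Y Z"
    then have "(\<lambda>n. projective_norm (X n - Y n) + projective_norm (Y n - Z n)) \<longlonglongrightarrow> 0 + 0"
      unfolding pt_eq_def by (intro tendsto_add) auto
    then have "(\<lambda>n. projective_norm (X n - Z n)) \<longlonglongrightarrow> 0"
      by (intro pt_tendsto_zero_le[OF projective_norm_triangle_diff]) simp
    then show "pt_eq X Z"
      using XY YZ by (simp add: pt_eq_def)
  qed
qed

text \<open>
  The completion of the algebraic tensor product for the projective norm: Cauchy sequences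
  modulo sequences tending to 0.
\<close>

quotient_type (overloaded) ('a, 'b) ptensor =
    "nat \<Rightarrow> ('a::complex_normed_vector, 'b::complex_normed_vector) atensor" / partial: pt_eq
  by (rule part_equivp_pt_eq)

lemma pt_Cauchy_const [simp]: "pt_Cauchy (\<lambda>_. t)"
  by (auto simp: pt_Cauchy_def)

lemma pt_Cauchy_add:
  assumes "pt_Cauchy X" "pt_Cauchy Y"
  shows "pt_Cauchy (\<lambda>n. X n + Y n)"
  unfolding pt_Cauchy_def
proof (intro allI impI)
  fix e :: real assume "0 < e"
  then have e2: "0 < e / 2"
    by simp
  obtain M N where MN: "\<And>m n. m \<ge> M \<Longrightarrow> n \<ge> M \<Longrightarrow> projective_norm (X m - X n) < e / 2"
      "\<And>m n. m \<ge> N \<Longrightarrow> n \<ge> N \<Longrightarrow> projective_norm (Y m - Y n) < e / 2"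
    using assms e2 unfolding pt_Cauchy_def by meson
  have "projective_norm (X m + Y m - (X n + Y n)) < e" if "m \<ge> max M N" "n \<ge> max M N" for m n
    using MN(1)[of m n] MN(2)[of m n] that projective_norm_triangle[of "X m - X n" "Y m - Y n"]
    by (simp add: algebra_simps)
  then show "\<exists>N. \<forall>m\<ge>N. \<forall>n\<ge>N. projective_norm (X m + Y m - (X n + Y n)) < e"
    by blast
qed

lemma pt_Cauchy_scaleC:
  assumes X: "pt_Cauchy X"
  shows "pt_Cauchy (\<lambda>n. c *\<^sub>C X n)"
proof (cases "c = 0")
  case False
  show ?thesis
    unfolding pt_Cauchy_def
  proof (intro allI impI)
    fix e :: real assume "0 < e"
    then have "0 < e / cmod c"
      using False by simp
    then obtain N where "\<And>m n. m \<ge> N \<Longrightarrow> n \<ge> N \<Longrightarrow> projective_norm (X m - X n) < e / cmod c"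
      using X unfolding pt_Cauchy_def by meson
    then show "\<exists>N. \<forall>m\<ge>N. \<forall>n\<ge>N. projective_norm (c *\<^sub>C X m - c *\<^sub>C X n) < e"
      using False by (auto simp: scaleC_diff_right[symmetric] projective_norm_scaleC field_simps)
  qed
qed simp

lemma pt_Cauchy_convergent:
  assumes X: "pt_Cauchy X"
  shows "convergent (\<lambda>n. projective_norm (X n))"
proof (rule Cauchy_convergent, rule metric_CauchyI)
  fix e :: real assume "0 < e"
  then obtain N where "\<forall>m\<ge>N. \<forall>n\<ge>N. projective_norm (X m - X n) < e"
    using X unfolding pt_Cauchy_def by meson
  then show "\<exists>N. \<forall>m\<ge>N. \<forall>n\<ge>N. dist (projective_norm (X m)) (projective_norm (X n)) < e"
    using projective_norm_reverse by (metis dist_real_def order_le_less_trans)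
qed

lemma pt_eq_lim:
  assumes "pt_eq X Y"
  shows "lim (\<lambda>n. projective_norm (X n)) = lim (\<lambda>n. projective_norm (Y n))"
proof -
  have X: "(\<lambda>n. projective_norm (X n)) \<longlonglongrightarrow> lim (\<lambda>n. projective_norm (X n))"
    using assms pt_Cauchy_convergent convergent_LIMSEQ_iff pt_eq_def by blast
  have "(\<lambda>n. projective_norm (Y n) - projective_norm (X n)) \<longlonglongrightarrow> 0"
  proof (rule Lim_null_comparison)
    show "\<forall>\<^sub>F n in sequentially.
        norm (projective_norm (Y n) - projective_norm (X n)) \<le> projective_norm (X n - Y n)"
      by (intro always_eventually allI)
        (metis projective_norm_reverse projective_norm_minus_commute real_norm_def)
    show "(\<lambda>n. projective_norm (X n - Y n)) \<longlonglongrightarrow> 0"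
      using assms by (simp add: pt_eq_def)
  qed
  from tendsto_add[OF this X] show ?thesis
    by (simp add: limI)
qed

instantiation ptensor :: (complex_normed_vector, complex_normed_vector) complex_normed_vector
begin
lift_definition zero_ptensor :: "('a, 'b) ptensor" is "\<lambda>_. 0"
  by (simp add: pt_eq_def)
lift_definition plus_ptensor :: "('a, 'b) ptensor \<Rightarrow> ('a, 'b) ptensor \<Rightarrow> ('a, 'b) ptensor"
  is "\<lambda>X Y n. X n + Y n"
proof -
  fix X X' Y Y' :: "nat \<Rightarrow> ('a, 'b) atensor"
  assume X: "pt_eq X X'" and Y: "pt_eq Y Y'"
  then have "(\<lambda>n. projective_norm (X n - X' n) + projective_norm (Y n - Y' n)) \<longlonglongrightarrow> 0 + 0"
    unfolding pt_eq_def by (intro tendsto_add) auto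
  moreover have "projective_norm (X n + Y n - (X' n + Y' n))
      \<le> projective_norm (X n - X' n) + projective_norm (Y n - Y' n)" for n
    using projective_norm_triangle[of "X n - X' n" "Y n - Y' n"] by (simp add: algebra_simps)
  ultimately have "(\<lambda>n. projective_norm (X n + Y n - (X' n + Y' n))) \<longlonglongrightarrow> 0"
    by (intro pt_tendsto_zero_le) auto
  then show "pt_eq (\<lambda>n. X n + Y n) (\<lambda>n. X' n + Y' n)"
    using X Y by (simp add: pt_eq_def pt_Cauchy_add)
qed
lift_definition scaleC_ptensor :: "complex \<Rightarrow> ('a, 'b) ptensor \<Rightarrow> ('a, 'b) ptensor"
  is "\<lambda>c X n. c *\<^sub>C X n"
  unfolding pt_eq_def
  by (simp add: pt_Cauchy_scaleC scaleC_diff_right[symmetric] projective_norm_scaleC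
      tendsto_mult_right_zero)
lift_definition norm_ptensor :: "('a, 'b) ptensor \<Rightarrow> real"
  is "\<lambda>X. lim (\<lambda>n. projective_norm (X n))"
  by (rule pt_eq_lim)
definition scaleR_ptensor :: "real \<Rightarrow> ('a, 'b) ptensor \<Rightarrow> ('a, 'b) ptensor" where
  "scaleR_ptensor r x = complex_of_real r *\<^sub>C x"
definition uminus_ptensor :: "('a, 'b) ptensor \<Rightarrow> ('a, 'b) ptensor" where
  "uminus_ptensor x = (-1) *\<^sub>C x"
definition minus_ptensor :: "('a, 'b) ptensor \<Rightarrow> ('a, 'b) ptensor \<Rightarrow> ('a, 'b) ptensor" where
  "minus_ptensor x y = x + (-1) *\<^sub>C y"
definition dist_ptensor :: "('a, 'b) ptensor \<Rightarrow> ('a, 'b) ptensor \<Rightarrow> real" where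
  "dist_ptensor x y = norm (x - y)"
definition sgn_ptensor :: "('a, 'b) ptensor \<Rightarrow> ('a, 'b) ptensor" where
  "sgn_ptensor x = inverse (norm x) *\<^sub>R x"
definition uniformity_ptensor :: "(('a, 'b) ptensor \<times> ('a, 'b) ptensor) filter" where
  "uniformity_ptensor = (INF e\<in>{0<..}. principal {(x, y). dist x y < e})"
definition open_ptensor :: "('a, 'b) ptensor set \<Rightarrow> bool" where
  "open_ptensor U = (\<forall>x\<in>U. eventually (\<lambda>(x', y). x' = x \<longrightarrow> y \<in> U) uniformity)"

instance
proof
  fix x y z :: "('a, 'b) ptensor" and c d :: complex and r q :: real
  have eqI2: "pt_eq X Y" if "pt_Cauchy X" "X = Y" for X Y :: "nat \<Rightarrow> ('a, 'b) atensor"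
    using that by (simp add: pt_eq_def)
  have C: "pt_Cauchy X" if "pt_eq X X" for X :: "nat \<Rightarrow> ('a, 'b) atensor"
    using that by (simp add: pt_eq_def)
  have L: "(\<lambda>n. projective_norm (X n)) \<longlonglongrightarrow> lim (\<lambda>n. projective_norm (X n))"
    if "pt_eq X X" for X :: "nat \<Rightarrow> ('a, 'b) atensor"
    using that pt_Cauchy_convergent convergent_LIMSEQ_iff pt_eq_def by blast
  show "x + y + z = x + (y + z)"
    by transfer (rule eqI2; simp add: pt_Cauchy_add pt_Cauchy_scaleC C add.assoc)
  show "x + y = y + x"
    by transfer (rule eqI2; simp add: pt_Cauchy_add pt_Cauchy_scaleC C add.commute)
  show "0 + x = x"
    by transfer (rule eqI2; simp add: C)
  show "- x + x = 0"
    unfolding uminus_ptensor_def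
    by transfer (rule eqI2; simp add: pt_Cauchy_add pt_Cauchy_scaleC C scaleC_minus_one)
  show "x - y = x + - y"
    by (simp add: minus_ptensor_def uminus_ptensor_def)
  show C1: "c *\<^sub>C (x + y) = c *\<^sub>C x + c *\<^sub>C y" for c and x y :: "('a, 'b) ptensor"
    by transfer (rule eqI2; simp add: pt_Cauchy_add pt_Cauchy_scaleC C scaleC_add_right)
  show C2: "(c + d) *\<^sub>C x = c *\<^sub>C x + d *\<^sub>C x" for c d and x :: "('a, 'b) ptensor"
    by transfer (rule eqI2; simp add: pt_Cauchy_add pt_Cauchy_scaleC C scaleC_add_left)
  show C3: "c *\<^sub>C d *\<^sub>C x = (c * d) *\<^sub>C x" for c d and x :: "('a, 'b) ptensor"
    by transfer (rule eqI2; simp add: pt_Cauchy_add pt_Cauchy_scaleC C scaleC_scaleC)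
  have C4: "1 *\<^sub>C x = x" for x :: "('a, 'b) ptensor"
    by transfer simp
  show "r *\<^sub>R x = complex_of_real r *\<^sub>C x"
    by (simp add: scaleR_ptensor_def)
  show "r *\<^sub>R (x + y) = r *\<^sub>R x + r *\<^sub>R y"
    by (simp add: scaleR_ptensor_def C1)
  show "(r + q) *\<^sub>R x = r *\<^sub>R x + q *\<^sub>R x"
    by (simp add: scaleR_ptensor_def C2)
  show "r *\<^sub>R q *\<^sub>R x = (r * q) *\<^sub>R x"
    by (simp add: scaleR_ptensor_def C3)
  show "1 *\<^sub>R x = x"
    by (simp add: scaleR_ptensor_def C4)
  show N: "norm (c *\<^sub>C x) = cmod c * norm x" for c and x :: "('a, 'b) ptensor"
    by transfer (simp add: projective_norm_scaleC limI[OF tendsto_mult_left[OF L]])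
  show "norm (r *\<^sub>R x) = \<bar>r\<bar> * norm x"
    by (simp add: scaleR_ptensor_def N)
  show "norm x = 0 \<longleftrightarrow> x = 0"
  proof transfer
    fix X :: "nat \<Rightarrow> ('a, 'b) atensor"
    assume X: "pt_eq X X"
    have "pt_eq X (\<lambda>_. 0) \<longleftrightarrow> (\<lambda>n. projective_norm (X n)) \<longlonglongrightarrow> 0"
      using X by (simp add: pt_eq_def)
    also have "\<dots> \<longleftrightarrow> lim (\<lambda>n. projective_norm (X n)) = 0"
      using L[OF X] LIMSEQ_unique by metis
    finally show "lim (\<lambda>n. projective_norm (X n)) = 0 \<longleftrightarrow> pt_eq X (\<lambda>_. 0)"
      by simp
  qed
  show "norm (x + y) \<le> norm x + norm y"
  proof transfer
    fix X Y :: "nat \<Rightarrow> ('a, 'b) atensor"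
    assume X: "pt_eq X X" and Y: "pt_eq Y Y"
    have "(\<lambda>n. projective_norm (X n + Y n)) \<longlonglongrightarrow> lim (\<lambda>n. projective_norm (X n + Y n))"
      using X Y by (intro L) (auto simp: pt_eq_def pt_Cauchy_add)
    then show "lim (\<lambda>n. projective_norm (X n + Y n))
        \<le> lim (\<lambda>n. projective_norm (X n)) + lim (\<lambda>n. projective_norm (Y n))"
      by (rule LIMSEQ_le[OF _ tendsto_add[OF L[OF X] L[OF Y]]])
        (auto simp: projective_norm_triangle)
  qed
  show "dist x y = norm (x - y)"
    by (simp add: dist_ptensor_def)
  show "sgn x = inverse (norm x) *\<^sub>R x"
    by (simp add: sgn_ptensor_def)
  show "uniformity = (INF e\<in>{0<..}. principal {(x, y :: ('a, 'b) ptensor). dist x y < e})"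
    by (simp add: uniformity_ptensor_def)
  fix U :: "('a, 'b) ptensor set"
  show "open U = (\<forall>x\<in>U. eventually (\<lambda>(x', y). x' = x \<longrightarrow> y \<in> U) uniformity)"
    by (simp add: open_ptensor_def)
qed
end


lemma pt_eq_rep_ptensor: "pt_eq (rep_ptensor x) (rep_ptensor x)"
  by (rule Quotient3_rep_reflp[OF Quotient3_ptensor])

lemma abs_rep_ptensor: "abs_ptensor (rep_ptensor x) = x"
  by (rule Quotient3_abs_rep[OF Quotient3_ptensor])

lemma pt_eq_iff_abs: "pt_eq X Y \<longleftrightarrow> pt_eq X X \<and> pt_eq Y Y \<and> abs_ptensor X = abs_ptensor Y"
  using Quotient3_rel[OF Quotient3_ptensor, of X Y] by blast

definition of_atensor ::
  "('a::complex_normed_vector, 'b::complex_normed_vector) atensor \<Rightarrow> ('a, 'b) ptensor" where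
  "of_atensor t = abs_ptensor (\<lambda>_. t)"

lemma pt_eq_const [simp]: "pt_eq (\<lambda>_. t) (\<lambda>_. t)"
  by (simp add: pt_eq_def)

lemma norm_of_atensor: "norm (of_atensor t) = projective_norm t"
  by (simp add: of_atensor_def norm_ptensor.abs_eq)

lemma of_atensor_add: "of_atensor (s + t) = of_atensor s + of_atensor t"
  by (simp add: of_atensor_def plus_ptensor.abs_eq)

lemma of_atensor_scaleC: "of_atensor (c *\<^sub>C t) = c *\<^sub>C of_atensor t"
  by (simp add: of_atensor_def scaleC_ptensor.abs_eq)

lemma of_atensor_diff: "of_atensor (s - t) = of_atensor s - of_atensor t"
  by (simp add: minus_atensor_def minus_ptensor_def of_atensor_add of_atensor_scaleC)

lemma of_atensor_zero: "of_atensor 0 = 0"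
  by (simp add: of_atensor_def zero_ptensor_def)

lemma norm_abs_ptensor_diff:
  assumes "pt_eq X X"
  shows "(\<lambda>m. projective_norm (X m - t)) \<longlonglongrightarrow> norm (abs_ptensor X - of_atensor t)"
proof -
  have C: "pt_Cauchy (\<lambda>m. X m + (-1) *\<^sub>C t)"
    using assms by (intro pt_Cauchy_add) (auto simp: pt_eq_def)
  have eq: "pt_eq (\<lambda>m. X m + (-1) *\<^sub>C t) (\<lambda>m. X m + (-1) *\<^sub>C t)"
    using C by (simp add: pt_eq_def)
  have "abs_ptensor X - of_atensor t = abs_ptensor (\<lambda>m. X m + (-1) *\<^sub>C t)"
    using assms
    by (simp add: minus_ptensor_def of_atensor_def plus_ptensor.abs_eq scaleC_ptensor.abs_eq)
  then have "norm (abs_ptensor X - of_atensor t) = lim (\<lambda>m. projective_norm (X m + (-1) *\<^sub>C t))"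
    using norm_ptensor.abs_eq[OF eq] by simp
  then show ?thesis
    using pt_Cauchy_convergent[OF C]
    by (simp add: convergent_LIMSEQ_iff scaleC_minus_one)
qed

lemma of_atensor_tendsto:
  assumes X: "pt_eq X X"
  shows "(\<lambda>n. of_atensor (X n)) \<longlonglongrightarrow> abs_ptensor X"
proof (rule metric_LIMSEQ_I)
  fix e :: real assume "0 < e"
  then have e2: "0 < e / 2"
    by simp
  from X have "pt_Cauchy X"
    by (simp add: pt_eq_def)
  then obtain N where N: "\<And>m n. m \<ge> N \<Longrightarrow> n \<ge> N \<Longrightarrow> projective_norm (X m - X n) < e / 2"
    using e2 unfolding pt_Cauchy_def by meson
  have "norm (abs_ptensor X - of_atensor (X n)) \<le> e / 2" if "n \<ge> N" for n
    using N that
    by (intro LIMSEQ_le_const2[OF norm_abs_ptensor_diff[OF X]] exI[of _ N]) (simp add: less_imp_le)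
  then show "\<exists>N. \<forall>n\<ge>N. dist (of_atensor (X n)) (abs_ptensor X) < e"
    using e2 by (intro exI[of _ N]) (fastforce simp: dist_norm norm_minus_commute)
qed

instance ptensor :: (complex_normed_vector, complex_normed_vector) complex_banach
proof
  fix S :: "nat \<Rightarrow> ('a, 'b) ptensor"
  assume S: "Cauchy S"
  have "\<exists>t. dist (S n) (of_atensor t) < inverse (Suc n)" for n
  proof -
    have "(0::real) < inverse (Suc n)"
      by simp
    then obtain k where "dist (of_atensor (rep_ptensor (S n) k)) (S n) < inverse (Suc n)"
      using of_atensor_tendsto[OF pt_eq_rep_ptensor, of "S n"]
      unfolding abs_rep_ptensor lim_sequentially by blast
    then show ?thesis
      by (intro exI[of _ "rep_ptensor (S n) k"]) (simp only: dist_commute)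
  qed
  then obtain T where T: "\<And>n. dist (S n) (of_atensor (T n)) < inverse (Suc n)"
    by metis
  have lim0: "(\<lambda>n. dist (S n) (of_atensor (T n))) \<longlonglongrightarrow> 0"
    by (rule tendsto_sandwich[OF _ _ tendsto_const LIMSEQ_inverse_real_of_nat])
      (use T in \<open>auto intro!: always_eventually less_imp_le simp del: of_nat_Suc\<close>)
  have "pt_Cauchy T"
    unfolding pt_Cauchy_def
  proof (intro allI impI)
    fix e :: real assume "0 < e"
    then have e3: "0 < e / 3"
      by simp
    obtain M where M: "\<And>m n. m \<ge> M \<Longrightarrow> n \<ge> M \<Longrightarrow> dist (S m) (S n) < e / 3"
      using S e3 unfolding Cauchy_def by meson
    obtain N where N: "\<And>n. n \<ge> N \<Longrightarrow> dist (S n) (of_atensor (T n)) < e / 3"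
      using order_tendstoD(2)[OF lim0 e3] by (auto simp: eventually_sequentially)
    have "projective_norm (T m - T n) < e" if "m \<ge> max M N" "n \<ge> max M N" for m n
    proof -
      have "projective_norm (T m - T n) = dist (of_atensor (T m)) (of_atensor (T n))"
        by (simp add: dist_norm norm_of_atensor[symmetric] of_atensor_diff)
      also have "\<dots> \<le> dist (S m) (of_atensor (T m)) + dist (S m) (S n)
          + dist (S n) (of_atensor (T n))"
        by (smt (verit) dist_commute dist_triangle)
      also have "\<dots> < e"
        using M[of m n] N[of m] N[of n] that by simp
      finally show ?thesis .
    qed
    then show "\<exists>N. \<forall>m\<ge>N. \<forall>n\<ge>N. projective_norm (T m - T n) < e"
      by blast
  qed
  then have "(\<lambda>n. of_atensor (T n)) \<longlonglongrightarrow> abs_ptensor T"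
    by (intro of_atensor_tendsto) (simp add: pt_eq_def)
  moreover have "(\<lambda>n. S n - of_atensor (T n)) \<longlonglongrightarrow> 0"
    using lim0 by (simp add: dist_norm tendsto_norm_zero_iff)
  ultimately have "(\<lambda>n. S n - of_atensor (T n) + of_atensor (T n)) \<longlonglongrightarrow> 0 + abs_ptensor T"
    by (intro tendsto_add)
  then show "convergent S"
    by (auto simp: convergent_def)
qed

definition elem_tensor ::
  "'a::complex_normed_vector \<Rightarrow> 'b::complex_normed_vector \<Rightarrow> ('a, 'b) ptensor" where
  "elem_tensor a b = of_atensor (abs_atensor [(a, b)])"

lemma of_atensor_abs: "of_atensor (abs_atensor u) = (\<Sum>(a, b)\<leftarrow>u. elem_tensor a b)"
proof (induction u)
  case Nil
  then show ?case
    by (simp add: zero_atensor.abs_eq[symmetric] of_atensor_zero)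
next
  case (Cons p u)
  obtain a b where p: "p = (a, b)"
    by fastforce
  have "abs_atensor (p # u) = abs_atensor [(a, b)] + abs_atensor u"
    by (simp add: plus_atensor.abs_eq p)
  then show ?case
    by (simp add: p of_atensor_add Cons.IH elem_tensor_def)
qed

lemma norm_sum_elem_tensor:
  "norm (\<Sum>(a, b)\<leftarrow>u. elem_tensor a b) = projective_norm (abs_atensor u)"
  by (simp add: of_atensor_abs[symmetric] norm_of_atensor)

lemma norm_elem_tensor_le: "norm (elem_tensor a b) \<le> norm a * norm b"
  using projective_norm_le[of "[(a, b)]"] by (simp add: elem_tensor_def norm_of_atensor)

lemma bounded_cbilinear_elem_tensor: "bounded_cbilinear elem_tensor"
proof -
  have add1: "elem_tensor (a + a') b = elem_tensor a b + elem_tensor a' b" for a a' :: 'a and b :: 'b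
    unfolding elem_tensor_def of_atensor_add[symmetric] plus_atensor.abs_eq
    by (rule arg_cong[of _ _ of_atensor]) (simp add: atensor.abs_eq_iff te_add_left)
  have add2: "elem_tensor a (b + b') = elem_tensor a b + elem_tensor a b'" for a :: 'a and b b' :: 'b
    unfolding elem_tensor_def of_atensor_add[symmetric] plus_atensor.abs_eq
    by (rule arg_cong[of _ _ of_atensor]) (simp add: atensor.abs_eq_iff te_add_right)
  have c1: "elem_tensor (c *\<^sub>C a) b = c *\<^sub>C elem_tensor a b" for c and a :: 'a and b :: 'b
    unfolding elem_tensor_def of_atensor_scaleC[symmetric] scaleC_atensor.abs_eq by simp
  have c2: "elem_tensor a (c *\<^sub>C b) = elem_tensor (c *\<^sub>C a) b" for c and a :: 'a and b :: 'b
    unfolding elem_tensor_def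
    by (rule arg_cong[of _ _ of_atensor]) (simp add: atensor.abs_eq_iff te_sym[OF te_scale])
  have "bounded_bilinear (elem_tensor :: 'a \<Rightarrow> 'b \<Rightarrow> _)"
    by standard (auto simp: add1 add2 scaleR_scaleC c1 c2 intro!: exI[of _ 1] norm_elem_tensor_le)
  then show ?thesis
    by (auto simp: bounded_cbilinear_def c1 c2)
qed

text \<open>The linearization of a bounded bilinear map, first on the algebraic tensor product.\<close>

definition alg_lift ::
  "('a::complex_normed_vector \<Rightarrow> 'b::complex_normed_vector \<Rightarrow> 'c::complex_normed_vector) \<Rightarrow>
   ('a, 'b) atensor \<Rightarrow> 'c" where
  "alg_lift h t = (\<Sum>(a, b)\<leftarrow>rep_atensor t. h a b)"

definition proj_lift ::
  "('a::complex_normed_vector \<Rightarrow> 'b::complex_normed_vector \<Rightarrow> 'c::complex_banach) \<Rightarrow>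
   ('a, 'b) ptensor \<Rightarrow> 'c" where
  "proj_lift h x = lim (\<lambda>n. alg_lift h (rep_ptensor x n))"

lemma tensor_eq_sum:
  assumes h: "bounded_cbilinear h"
  shows "tensor_eq u v \<Longrightarrow> (\<Sum>(a, b)\<leftarrow>u. h a b) = (\<Sum>(a, b)\<leftarrow>v. h a b)"
proof -
  interpret bounded_bilinear h
    using h by (simp add: bounded_cbilinear_def)
  show "tensor_eq u v \<Longrightarrow> (\<Sum>(a, b)\<leftarrow>u. h a b) = (\<Sum>(a, b)\<leftarrow>v. h a b)"
    by (induction rule: tensor_eq.induct)
      (use h in \<open>auto simp: bounded_cbilinear_def add_left add_right zero_left add.commute\<close>)
qed

lemma alg_lift_abs:
  assumes h: "bounded_cbilinear h"
  shows "alg_lift h (abs_atensor u) = (\<Sum>(a, b)\<leftarrow>u. h a b)"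
  unfolding alg_lift_def
  by (rule tensor_eq_sum[OF h]) (simp add: Quotient3_rep_abs[OF Quotient3_atensor] te_refl)

lemma alg_lift_add:
  assumes h: "bounded_cbilinear h"
  shows "alg_lift h (s + t) = alg_lift h s + alg_lift h t"
proof -
  obtain u v where "s = abs_atensor u" "t = abs_atensor v"
    using Quotient3_abs_rep[OF Quotient3_atensor] by metis
  then show ?thesis
    by (simp add: plus_atensor.abs_eq alg_lift_abs[OF h])
qed

lemma alg_lift_scaleC:
  assumes h: "bounded_cbilinear h"
  shows "alg_lift h (c *\<^sub>C t) = c *\<^sub>C alg_lift h t"
proof -
  obtain u where u: "t = abs_atensor u"
    using Quotient3_abs_rep[OF Quotient3_atensor] by metis
  have "(\<Sum>(a, b)\<leftarrow>map (\<lambda>(a, b). (c *\<^sub>C a, b)) u. h a b) = c *\<^sub>C (\<Sum>(a, b)\<leftarrow>u. h a b)"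
    using h by (induction u) (auto simp: bounded_cbilinear_def scaleC_add_right)
  then show ?thesis
    by (simp add: u scaleC_atensor.abs_eq alg_lift_abs[OF h])
qed

lemma alg_lift_diff:
  assumes h: "bounded_cbilinear h"
  shows "alg_lift h (s - t) = alg_lift h s - alg_lift h t"
  using alg_lift_add[OF h, of s "- t"] alg_lift_scaleC[OF h, of "-1" t]
  by (simp add: scaleC_minus_one)

lemma norm_alg_lift_le:
  assumes h: "bounded_cbilinear h" and K: "0 < K" "\<And>a b. norm (h a b) \<le> K * (norm a * norm b)"
  shows "norm (alg_lift h t) \<le> K * projective_norm t"
proof -
  have "norm (alg_lift h t) / K \<le> projective_norm t"
  proof (rule projective_norm_greatest)
    fix u assume "abs_atensor u = t"
    moreover have "norm (\<Sum>(a, b)\<leftarrow>u. h a b) \<le> K * list_weight u"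
    proof (induction u)
      case (Cons p u)
      obtain a b where p: "p = (a, b)"
        by fastforce
      show ?case
        using Cons.IH K(2)[of a b] norm_triangle_ineq[of "h a b" "\<Sum>(a, b)\<leftarrow>u. h a b"]
        by (simp add: p distrib_left)
    qed simp
    ultimately show "norm (alg_lift h t) / K \<le> list_weight u"
      using K(1) alg_lift_abs[OF h, of u] by (simp add: field_simps)
  qed
  then show ?thesis
    using K(1) by (simp add: field_simps)
qed

lemma bounded_cbilinear_pos_bounded:
  assumes "bounded_cbilinear h"
  obtains K where "0 < K" "\<And>a b. norm (h a b) \<le> K * (norm a * norm b)"
  using assms bounded_bilinear.pos_bounded[of h]
  by (auto simp: bounded_cbilinear_def mult_ac)

lemma proj_lift_LIMSEQ:
  assumes h: "bounded_cbilinear h" and X: "pt_eq X X"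
  shows "(\<lambda>n. alg_lift h (X n)) \<longlonglongrightarrow> proj_lift h (abs_ptensor X)"
proof -
  obtain K where K: "0 < K" "\<And>a b. norm (h a b) \<le> K * (norm a * norm b)"
    using bounded_cbilinear_pos_bounded[OF h] by blast
  let ?R = "rep_ptensor (abs_ptensor X)"
  have R: "pt_eq ?R ?R" "pt_eq X ?R"
    using pt_eq_rep_ptensor abs_rep_ptensor X pt_eq_iff_abs by metis+
  have "Cauchy (\<lambda>n. alg_lift h (?R n))"
  proof (rule metric_CauchyI)
    fix e :: real assume "0 < e"
    then have "0 < e / K"
      using K by simp
    then obtain N where N: "\<And>m n. m \<ge> N \<Longrightarrow> n \<ge> N \<Longrightarrow> projective_norm (?R m - ?R n) < e / K"
      using R(1) unfolding pt_eq_def pt_Cauchy_def by meson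
    have "dist (alg_lift h (?R m)) (alg_lift h (?R n)) < e" if "m \<ge> N" "n \<ge> N" for m n
      using norm_alg_lift_le[OF h K, of "?R m - ?R n"] N[OF that] K(1)
      by (simp add: dist_norm alg_lift_diff[OF h] field_simps)
    then show "\<exists>N. \<forall>m\<ge>N. \<forall>n\<ge>N. dist (alg_lift h (?R m)) (alg_lift h (?R n)) < e"
      by blast
  qed
  then have 1: "(\<lambda>n. alg_lift h (?R n)) \<longlonglongrightarrow> proj_lift h (abs_ptensor X)"
    by (simp add: proj_lift_def Cauchy_convergent_iff convergent_LIMSEQ_iff)
  have "(\<lambda>n. K * projective_norm (X n - ?R n)) \<longlonglongrightarrow> 0"
    using R(2) by (intro tendsto_mult_right_zero) (simp add: pt_eq_def)
  then have "(\<lambda>n. alg_lift h (X n) - alg_lift h (?R n)) \<longlonglongrightarrow> 0"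
    by (rule Lim_null_comparison[rotated])
      (simp add: alg_lift_diff[OF h, symmetric] norm_alg_lift_le[OF h K])
  from tendsto_add[OF this 1] show ?thesis
    by simp
qed

lemma proj_lift_of_atensor:
  "bounded_cbilinear h \<Longrightarrow> proj_lift h (of_atensor t) = alg_lift h t"
  using proj_lift_LIMSEQ[of h "\<lambda>_. t"] by (simp add: of_atensor_def LIMSEQ_const_iff)

lemma proj_lift_elem_tensor:
  "bounded_cbilinear h \<Longrightarrow> proj_lift h (elem_tensor a b) = h a b"
  by (simp add: elem_tensor_def proj_lift_of_atensor alg_lift_abs)

lemma norm_proj_lift_le:
  assumes h: "bounded_cbilinear h" and K: "0 \<le> K" "\<And>a b. norm (h a b) \<le> K * (norm a * norm b)"
  shows "norm (proj_lift h x) \<le> K * norm x"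
proof (rule field_le_epsilon)
  fix e :: real assume e: "0 < e"
  define K' where "K' = K + e / (norm x + 1)"
  have nx: "0 < norm x + 1"
    by (simp add: add_nonneg_pos)
  have K': "0 < K'" "norm (h a b) \<le> K' * (norm a * norm b)" for a b
  proof -
    have "0 < e / (norm x + 1)"
      using e nx by simp
    then show "0 < K'"
      using K(1) by (simp add: K'_def)
    have "K * (norm a * norm b) \<le> K' * (norm a * norm b)"
      using \<open>0 < e / (norm x + 1)\<close> by (intro mult_right_mono) (auto simp: K'_def)
    then show "norm (h a b) \<le> K' * (norm a * norm b)"
      using K(2)[of a b] by linarith
  qed
  let ?R = "rep_ptensor x"
  have "(\<lambda>n. norm (alg_lift h (?R n))) \<longlonglongrightarrow> norm (proj_lift h x)"
    using proj_lift_LIMSEQ[OF h pt_eq_rep_ptensor, of x]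
    by (intro tendsto_norm) (simp add: abs_rep_ptensor)
  moreover have "(\<lambda>n. K' * projective_norm (?R n)) \<longlonglongrightarrow> K' * norm x"
    using norm_abs_ptensor_diff[OF pt_eq_rep_ptensor, of x 0]
    by (intro tendsto_mult_left) (simp add: abs_rep_ptensor of_atensor_zero)
  ultimately have "norm (proj_lift h x) \<le> K' * norm x"
    by (rule LIMSEQ_le) (use norm_alg_lift_le[OF h K'] in blast)
  also have "\<dots> = K * norm x + e * (norm x / (norm x + 1))"
    by (simp add: K'_def distrib_right)
  also have "\<dots> \<le> K * norm x + e"
    using e nx by (intro add_left_mono mult_left_le) (auto simp: field_simps)
  finally show "norm (proj_lift h x) \<le> K * norm x + e" .
qed

lemma bounded_clinear_proj_lift:
  assumes h: "bounded_cbilinear h"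
  shows "bounded_clinear (proj_lift h)"
proof -
  obtain K where K: "0 < K" "\<And>a b. norm (h a b) \<le> K * (norm a * norm b)"
    using bounded_cbilinear_pos_bounded[OF h] by blast
  have lim: "(\<lambda>n. alg_lift h (rep_ptensor x n)) \<longlonglongrightarrow> proj_lift h x" for x
    using proj_lift_LIMSEQ[OF h pt_eq_rep_ptensor, of x] by (simp add: abs_rep_ptensor)
  have add: "proj_lift h (x + y) = proj_lift h x + proj_lift h y" for x y
  proof -
    let ?X = "\<lambda>n. rep_ptensor x n + rep_ptensor y n"
    have X: "pt_eq ?X ?X"
      using pt_eq_rep_ptensor[of x] pt_eq_rep_ptensor[of y] by (simp add: pt_eq_def pt_Cauchy_add)
    have "abs_ptensor ?X = x + y"
      using plus_ptensor.abs_eq[OF pt_eq_rep_ptensor[of x] pt_eq_rep_ptensor[of y]]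
      by (simp add: abs_rep_ptensor)
    then have "(\<lambda>n. alg_lift h (?X n)) \<longlonglongrightarrow> proj_lift h (x + y)"
      using proj_lift_LIMSEQ[OF h X] by simp
    moreover have "(\<lambda>n. alg_lift h (?X n)) \<longlonglongrightarrow> proj_lift h x + proj_lift h y"
      by (simp add: alg_lift_add[OF h] tendsto_add[OF lim lim])
    ultimately show ?thesis
      by (rule LIMSEQ_unique)
  qed
  have scale: "proj_lift h (c *\<^sub>C x) = c *\<^sub>C proj_lift h x" for c x
  proof -
    let ?X = "\<lambda>n. c *\<^sub>C rep_ptensor x n"
    have X: "pt_eq ?X ?X"
      using pt_eq_rep_ptensor[of x] by (simp add: pt_eq_def pt_Cauchy_scaleC)
    have "abs_ptensor ?X = c *\<^sub>C x"
      using scaleC_ptensor.abs_eq[OF pt_eq_rep_ptensor[of x]] by (simp add: abs_rep_ptensor)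
    then have 1: "(\<lambda>n. alg_lift h (?X n)) \<longlonglongrightarrow> proj_lift h (c *\<^sub>C x)"
      using proj_lift_LIMSEQ[OF h X] by simp
    have "(\<lambda>n. cmod c * norm (alg_lift h (rep_ptensor x n) - proj_lift h x)) \<longlonglongrightarrow> 0"
      using lim[of x] by (intro tendsto_mult_right_zero) (simp add: LIM_zero_iff tendsto_norm_zero)
    then have "(\<lambda>n. alg_lift h (?X n) - c *\<^sub>C proj_lift h x) \<longlonglongrightarrow> 0"
      by (rule Lim_null_comparison[rotated])
        (simp add: alg_lift_scaleC[OF h] scaleC_diff_right[symmetric] norm_scaleC)
    then have "(\<lambda>n. alg_lift h (?X n)) \<longlonglongrightarrow> c *\<^sub>C proj_lift h x"
      by (simp add: LIM_zero_iff)
    with 1 show ?thesis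
      by (rule LIMSEQ_unique)
  qed
  have "bounded_linear (proj_lift h)"
    using norm_proj_lift_le[OF h _ K(2)] K(1)
    by (intro bounded_linear_intro[of _ K]) (auto simp: add scale scaleR_scaleC mult.commute)
  then show ?thesis
    by (simp add: bounded_clinear_def scale)
qed

lemma ptensor_clinear_eqI:
  assumes f: "bounded_clinear f" and g: "bounded_clinear g"
    and eq: "\<And>a b. f (elem_tensor a b) = g (elem_tensor a b)"
  shows "f x = g x"
proof -
  interpret f: bounded_linear f using f by (simp add: bounded_clinear_def)
  interpret g: bounded_linear g using g by (simp add: bounded_clinear_def)
  have "f (\<Sum>(a, b)\<leftarrow>u. elem_tensor a b) = g (\<Sum>(a, b)\<leftarrow>u. elem_tensor a b)" for u
    by (induction u) (auto simp: f.add g.add f.zero g.zero eq)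
  then have eq': "f (of_atensor t) = g (of_atensor t)" for t
    using of_atensor_abs[of "rep_atensor t"] by (simp add: Quotient3_abs_rep[OF Quotient3_atensor])
  have lim: "(\<lambda>n. of_atensor (rep_ptensor x n)) \<longlonglongrightarrow> x"
    using of_atensor_tendsto[OF pt_eq_rep_ptensor, of x] by (simp add: abs_rep_ptensor)
  show ?thesis
    by (rule LIMSEQ_unique[OF f.tendsto[OF lim]]) (simp add: eq' g.tendsto[OF lim])
qed



section \<open>Banach bimodules\<close>

text \<open>
  A bimodule structure is given by its left action \<open>l a x = a \<cdot> x\<close> and its right action
  \<open>r x a = x \<cdot> a\<close>.
\<close>

definition banach_bimodule ::
  "('a::complex_banach_algebra \<Rightarrow> 'x::complex_banach \<Rightarrow> 'x) \<Rightarrow> ('x \<Rightarrow> 'a \<Rightarrow> 'x) \<Rightarrow> bool" where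
  "banach_bimodule l r \<longleftrightarrow> bounded_cbilinear l \<and> bounded_cbilinear r \<and>
     (\<forall>a b x. l (a * b) x = l a (l b x) \<and> r x (a * b) = r (r x a) b \<and>
        l a (r x b) = r (l a x) b)"

definition dual_left ::
  "('x::complex_normed_vector \<Rightarrow> 'a \<Rightarrow> 'x) \<Rightarrow> 'a \<Rightarrow> 'x cdual \<Rightarrow> 'x cdual" where
  "dual_left r a f = adjoint_map (\<lambda>x. r x a) f"

definition dual_right ::
  "('a \<Rightarrow> 'x::complex_normed_vector \<Rightarrow> 'x) \<Rightarrow> 'x cdual \<Rightarrow> 'a \<Rightarrow> 'x cdual" where
  "dual_right l f a = adjoint_map (\<lambda>x. l a x) f"

abbreviation bidual_left ::
  "('a \<Rightarrow> 'x::complex_normed_vector \<Rightarrow> 'x) \<Rightarrow> 'a \<Rightarrow> 'x cdual cdual \<Rightarrow> 'x cdual cdual" where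
  "bidual_left l \<equiv> dual_left (dual_right l)"

abbreviation bidual_right ::
  "('x::complex_normed_vector \<Rightarrow> 'a \<Rightarrow> 'x) \<Rightarrow> 'x cdual cdual \<Rightarrow> 'a \<Rightarrow> 'x cdual cdual" where
  "bidual_right r \<equiv> dual_right (dual_left r)"

definition tensor_left ::
  "'a::complex_banach_algebra \<Rightarrow> ('a, 'a) ptensor \<Rightarrow> ('a, 'a) ptensor" where
  "tensor_left a = proj_lift (\<lambda>b c. elem_tensor (a * b) c)"

definition tensor_right ::
  "('a, 'a) ptensor \<Rightarrow> 'a::complex_banach_algebra \<Rightarrow> ('a, 'a) ptensor" where
  "tensor_right x a = proj_lift (\<lambda>b c. elem_tensor b (c * a)) x"

definition product_map :: "('a::complex_banach_algebra, 'a) ptensor \<Rightarrow> 'a" where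
  "product_map = proj_lift (*)"

lemma bounded_cbilinearI:
  assumes "\<And>x x' y. h (x + x') y = h x y + h x' y" "\<And>x y y'. h x (y + y') = h x y + h x y'"
    and "\<And>c x y. h (c *\<^sub>C x) y = c *\<^sub>C h x y" "\<And>c x y. h x (c *\<^sub>C y) = c *\<^sub>C h x y"
    and "\<And>x y. norm (h x y) \<le> norm x * norm y * K"
  shows "bounded_cbilinear h"
proof -
  have "bounded_bilinear h"
    by standard (use assms in \<open>auto simp: scaleR_scaleC\<close>)
  then show ?thesis
    using assms by (simp add: bounded_cbilinear_def)
qed

lemma bounded_cbilinear_comp:
  "bounded_cbilinear h \<Longrightarrow> bounded_clinear f \<Longrightarrow> bounded_clinear g \<Longrightarrow>
     bounded_cbilinear (\<lambda>x y. h (f x) (g y))"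
  by (simp add: bounded_cbilinear_def bounded_clinear_def bounded_bilinear.comp)

lemma bounded_clinear_ident: "bounded_clinear (\<lambda>x. x)"
  by (simp add: bounded_clinear_def bounded_linear_ident)

lemma bounded_cbilinear_tensor_left_aux:
  "bounded_cbilinear (\<lambda>b c. elem_tensor (a * b) c)" for a :: "'a::complex_banach_algebra"
  by (intro bounded_cbilinear_comp[OF bounded_cbilinear_elem_tensor]
      bounded_cbilinear_right[OF bounded_cbilinear_mult] bounded_clinear_ident)

lemma bounded_cbilinear_tensor_right_aux:
  "bounded_cbilinear (\<lambda>b c. elem_tensor b (c * a))" for a :: "'a::complex_banach_algebra"
  by (intro bounded_cbilinear_comp[OF bounded_cbilinear_elem_tensor]
      bounded_cbilinear_left[OF bounded_cbilinear_mult] bounded_clinear_ident)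

lemma tensor_left_elem [simp]: "tensor_left a (elem_tensor b c) = elem_tensor (a * b) c"
  by (simp add: tensor_left_def proj_lift_elem_tensor bounded_cbilinear_tensor_left_aux)

lemma tensor_right_elem [simp]: "tensor_right (elem_tensor b c) a = elem_tensor b (c * a)"
  by (simp add: tensor_right_def proj_lift_elem_tensor bounded_cbilinear_tensor_right_aux)

lemma product_map_elem [simp]: "product_map (elem_tensor a b) = a * b"
  by (simp add: product_map_def proj_lift_elem_tensor bounded_cbilinear_mult)

lemma bounded_clinear_tensor_left: "bounded_clinear (tensor_left a)"
  unfolding tensor_left_def
  by (rule bounded_clinear_proj_lift[OF bounded_cbilinear_tensor_left_aux])

lemma bounded_clinear_tensor_right: "bounded_clinear (\<lambda>x. tensor_right x a)"
  unfolding tensor_right_def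
  by (rule bounded_clinear_proj_lift[OF bounded_cbilinear_tensor_right_aux])

lemma bounded_clinear_product_map: "bounded_clinear product_map"
  unfolding product_map_def by (rule bounded_clinear_proj_lift[OF bounded_cbilinear_mult])

lemma bounded_clinear_add:
  "bounded_clinear f \<Longrightarrow> bounded_clinear g \<Longrightarrow> bounded_clinear (\<lambda>x. f x + g x)"
  by (simp add: bounded_clinear_def bounded_linear_add scaleC_add_right)

lemma bounded_clinear_scaleC:
  assumes f: "bounded_clinear f"
  shows "bounded_clinear (\<lambda>x. c *\<^sub>C f x)"
proof -
  have "bounded_linear (\<lambda>x::'b. c *\<^sub>C x)"
    by (intro bounded_linear_intro[of _ "cmod c"])
      (auto simp: scaleC_add_right scaleR_scaleC scaleC_scaleC norm_scaleC mult.commute)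
  then show ?thesis
    using f by (auto simp: bounded_clinear_def scaleC_scaleC mult.commute bounded_linear_compose)
qed

lemma bounded_cbilinear_tensor_left:
  "bounded_cbilinear (tensor_left :: 'a::complex_banach_algebra \<Rightarrow> _)"
proof (rule bounded_cbilinearI[where K = 1])
  note E = bounded_cbilinear_elem_tensor[unfolded bounded_cbilinear_def]
  fix a a' :: 'a and x y :: "('a, 'a) ptensor" and c
  show "tensor_left (a + a') x = tensor_left a x + tensor_left a' x"
    by (rule ptensor_clinear_eqI)
      (auto simp: distrib_right bounded_bilinear.add_left[OF conjunct1[OF E]]
        intro!: bounded_clinear_add bounded_clinear_tensor_left)
  show "tensor_left (c *\<^sub>C a) x = c *\<^sub>C tensor_left a x"
    by (rule ptensor_clinear_eqI)
      (use E in \<open>auto simp: mult_scaleC_left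
        intro!: bounded_clinear_scaleC bounded_clinear_tensor_left\<close>)
  show "tensor_left a (x + y) = tensor_left a x + tensor_left a y"
    "tensor_left a (c *\<^sub>C x) = c *\<^sub>C tensor_left a x"
    using bounded_clinear_tensor_left[of a]
    by (auto simp: bounded_clinear_def bounded_linear.linear linear_add)
  have "norm (elem_tensor (a * b) d) \<le> norm a * (norm b * norm d)" for b d :: 'a
    using norm_elem_tensor_le[of "a * b" d]
      mult_right_mono[OF norm_mult_ineq[of a b] norm_ge_zero[of d]] by (simp add: mult.assoc)
  then show "norm (tensor_left a x) \<le> norm a * norm x * 1"
    using norm_proj_lift_le[OF bounded_cbilinear_tensor_left_aux[of a], of "norm a" x]
    by (simp add: tensor_left_def)
qed

lemma bounded_cbilinear_tensor_right:
  "bounded_cbilinear (tensor_right :: _ \<Rightarrow> 'a::complex_banach_algebra \<Rightarrow> _)"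
proof (rule bounded_cbilinearI[where K = 1])
  note E = bounded_cbilinear_elem_tensor[unfolded bounded_cbilinear_def]
  fix a a' :: 'a and x y :: "('a, 'a) ptensor" and c
  show "tensor_right x (a + a') = tensor_right x a + tensor_right x a'"
    by (rule ptensor_clinear_eqI)
      (auto simp: distrib_left bounded_bilinear.add_right[OF conjunct1[OF E]]
        intro!: bounded_clinear_add bounded_clinear_tensor_right)
  show "tensor_right x (c *\<^sub>C a) = c *\<^sub>C tensor_right x a"
    by (rule ptensor_clinear_eqI)
      (use E in \<open>auto simp: mult_scaleC_right
        intro!: bounded_clinear_scaleC bounded_clinear_tensor_right\<close>)
  show "tensor_right (x + y) a = tensor_right x a + tensor_right y a"
    "tensor_right (c *\<^sub>C x) a = c *\<^sub>C tensor_right x a"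
    using bounded_clinear_tensor_right[of a]
    by (auto simp: bounded_clinear_def bounded_linear.linear linear_add[of "\<lambda>x. tensor_right x a"])
  have "norm (elem_tensor b (d * a)) \<le> norm a * (norm b * norm d)" for b d :: 'a
    using norm_elem_tensor_le[of b "d * a"]
      mult_left_mono[OF norm_mult_ineq[of d a] norm_ge_zero[of b]] by (simp add: mult_ac)
  then show "norm (tensor_right x a) \<le> norm x * norm a * 1"
    using norm_proj_lift_le[OF bounded_cbilinear_tensor_right_aux[of a], of "norm a" x]
    by (simp add: tensor_right_def mult.commute)
qed

lemma banach_bimodule_self:
  "banach_bimodule ((*) :: 'a::complex_banach_algebra \<Rightarrow> _) (*)"
  by (simp add: banach_bimodule_def bounded_cbilinear_mult mult.assoc)

lemma banach_bimodule_ptensor: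
  "banach_bimodule (tensor_left :: 'a::complex_banach_algebra \<Rightarrow> _) tensor_right"
  unfolding banach_bimodule_def
proof (intro conjI allI bounded_cbilinear_tensor_left bounded_cbilinear_tensor_right)
  fix a b :: 'a and x
  note L = bounded_clinear_tensor_left and R = bounded_clinear_tensor_right
  show "tensor_left (a * b) x = tensor_left a (tensor_left b x)"
    by (rule ptensor_clinear_eqI[OF L bounded_clinear_compose[OF L L]]) (simp add: mult.assoc)
  show "tensor_right x (a * b) = tensor_right (tensor_right x a) b"
    by (rule ptensor_clinear_eqI[OF R bounded_clinear_compose[OF R R]]) (simp add: mult.assoc)
  show "tensor_left a (tensor_right x b) = tensor_right (tensor_left a x) b"
    by (rule ptensor_clinear_eqI[OF bounded_clinear_compose[OF L R] bounded_clinear_compose[OF R L]])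
      simp
qed

lemma dual_left_apply:
  "bounded_cbilinear r \<Longrightarrow> cdual_apply (dual_left r a f) x = cdual_apply f (r x a)"
  by (simp add: dual_left_def adjoint_map_apply bounded_cbilinear_left)

lemma dual_right_apply:
  "bounded_cbilinear l \<Longrightarrow> cdual_apply (dual_right l f a) x = cdual_apply f (l a x)"
  by (simp add: dual_right_def adjoint_map_apply bounded_cbilinear_right)

lemma bounded_cbilinear_dual_left:
  assumes r: "bounded_cbilinear r"
  shows "bounded_cbilinear (dual_left r)"
proof -
  obtain K where K: "0 < K" "\<And>x a. norm (r x a) \<le> K * (norm x * norm a)"
    using bounded_cbilinear_pos_bounded[OF r] by blast
  have F: "bounded_linear (cdual_apply f)" "cdual_apply f (c *\<^sub>C x) = c * cdual_apply f x"
    for f :: "'a cdual" and c x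
    using bounded_clinear_cdual_apply[of f] by (auto simp: bounded_clinear_def scaleC_complex_def)
  have add: "cdual_apply f (x + y) = cdual_apply f x + cdual_apply f y" for f :: "'a cdual" and x y
    using F(1) by (simp add: bounded_linear.linear linear_add)
  show ?thesis
  proof (rule bounded_cbilinearI[where K = K])
    fix a f
    show "norm (dual_left r a f) \<le> norm a * norm f * K"
    proof (rule norm_cdual_bound)
      fix x
      have "norm (cdual_apply f (r x a)) \<le> norm f * (K * (norm x * norm a))"
        using norm_cdual_apply[of f "r x a"] mult_left_mono[OF K(2) norm_ge_zero] order_trans
        by blast
      then show "norm (cdual_apply (dual_left r a f) x) \<le> norm a * norm f * K * norm x"
        by (simp add: dual_left_apply[OF r] mult_ac)
    qed (use K in simp)
  qed (use r in \<open>auto intro!: cdual_eqI simp: dual_left_apply[OF r] cdual_apply_simps F(2) add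
        bounded_cbilinear_def bounded_bilinear.add_right\<close>)
qed

lemma bounded_cbilinear_dual_right:
  assumes l: "bounded_cbilinear l"
  shows "bounded_cbilinear (dual_right l)"
proof -
  have l': "bounded_cbilinear (\<lambda>x a. l a x)"
    using l by (auto simp: bounded_cbilinear_def intro: bounded_bilinear.flip)
  have "dual_right l = (\<lambda>f a. dual_left (\<lambda>x a. l a x) a f)"
    by (simp add: dual_left_def dual_right_def fun_eq_iff)
  then show ?thesis
    using bounded_cbilinear_dual_left[OF l']
    by (auto simp: bounded_cbilinear_def intro: bounded_bilinear.flip)
qed

lemma banach_bimodule_dual:
  assumes "banach_bimodule l r"
  shows "banach_bimodule (dual_left r) (dual_right l)"
  using assms unfolding banach_bimodule_def
  by (auto intro!: cdual_eqI
      simp: bounded_cbilinear_dual_left bounded_cbilinear_dual_right dual_left_apply dual_right_apply)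


section \<open>Nets\<close>

definition directed_set :: "'i set \<Rightarrow> ('i \<Rightarrow> 'i \<Rightarrow> bool) \<Rightarrow> bool" where
  "directed_set I le \<longleftrightarrow> I \<noteq> {} \<and> (\<forall>i\<in>I. le i i) \<and>
     (\<forall>i\<in>I. \<forall>j\<in>I. \<forall>k\<in>I. le i j \<longrightarrow> le j k \<longrightarrow> le i k) \<and>
     (\<forall>i\<in>I. \<forall>j\<in>I. \<exists>k\<in>I. le i k \<and> le j k)"

text \<open>
  The filter of tails, so that \<open>(m \<longlongrightarrow> l) (net_filter I le)\<close> is convergence of the net \<open>m\<close>.
\<close>

definition net_filter :: "'i set \<Rightarrow> ('i \<Rightarrow> 'i \<Rightarrow> bool) \<Rightarrow> 'i filter" where
  "net_filter I le = (INF i\<in>I. principal {j \<in> I. le i j})"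

text \<open>
  An existential quantifier cannot range over all index types.  By \<open>net_reindex\<close> below,
  every net in \<open>'x\<close>, whatever its index type, has the same values and the same convergence
  behaviour as one whose index set consists of elements of \<open>'x \<times> 'x set\<close>.  Quantifying over
  such index sets therefore loses no nets.
\<close>

type_synonym 'x net_index = "'x \<times> 'x set"

lemma directed_setD:
  assumes "directed_set I le"
  shows "I \<noteq> {}"
    and "i \<in> I \<Longrightarrow> le i i"
    and "i \<in> I \<Longrightarrow> j \<in> I \<Longrightarrow> \<exists>k\<in>I. le i k \<and> le j k"
    and "i \<in> I \<Longrightarrow> k \<in> I \<Longrightarrow> le i k \<Longrightarrow> {n \<in> I. le k n} \<subseteq> {n \<in> I. le i n}"
  using assms unfolding directed_set_def by blast+

lemma eventually_net_filter:
  assumes I: "directed_set I le"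
  shows "eventually P (net_filter I le) \<longleftrightarrow> (\<exists>i\<in>I. \<forall>j\<in>I. le i j \<longrightarrow> P j)"
proof -
  have "eventually P (net_filter I le) \<longleftrightarrow> (\<exists>i\<in>I. eventually P (principal {j \<in> I. le i j}))"
    unfolding net_filter_def
  proof (rule eventually_INF_base)
    fix i j assume ij: "i \<in> I" "j \<in> I"
    obtain k where k: "k \<in> I" "le i k" "le j k"
      using directed_setD(3)[OF I ij] by blast
    have "{n \<in> I. le k n} \<subseteq> {n \<in> I. le i n} \<inter> {n \<in> I. le j n}"
      using directed_setD(4)[OF I ij(1) k(1,2)] directed_setD(4)[OF I ij(2) k(1,3)] by blast
    then show "\<exists>x\<in>I. principal {n \<in> I. le x n}
        \<le> inf (principal {n \<in> I. le i n}) (principal {n \<in> I. le j n})"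
      using k(1) by (intro bexI[of _ k]) (simp_all only: inf_principal principal_le_iff)
  qed (rule directed_setD(1)[OF I])
  then show ?thesis
    by (auto simp: eventually_principal)
qed

lemma net_reindex:
  fixes m :: "'i \<Rightarrow> 'x"
  assumes I: "directed_set I le"
  shows "\<exists>(J :: 'x net_index set) le' n. directed_set J le' \<and> n ` J = m ` I \<and>
           filtermap n (net_filter J le') = filtermap m (net_filter I le)"
proof -
  define S where "S i = m ` {j \<in> I. le i j}" for i
  define J where "J = {(x, T). \<exists>i\<in>I. T = S i \<and> x \<in> T}"
  define le' where "le' p q \<longleftrightarrow> snd q \<subseteq> snd p" for p q :: "'x net_index"
  have refl: "m i \<in> S i" if "i \<in> I" for i
    using directed_setD(2)[OF I that] that by (simp add: S_def)
  have J_I: "(m i, S i) \<in> J" if "i \<in> I" for i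
    using that refl by (auto simp: J_def)
  have J: "directed_set J le'"
    unfolding directed_set_def
  proof (intro conjI ballI)
    show "J \<noteq> {}"
      using directed_setD(1)[OF I] J_I by blast
    fix p q assume "p \<in> J" "q \<in> J"
    then obtain i j where ij: "i \<in> I" "j \<in> I" "snd p = S i" "snd q = S j"
      by (auto simp: J_def)
    then obtain k where k: "k \<in> I" "le i k" "le j k"
      using directed_setD(3)[OF I] by blast
    then have "S k \<subseteq> S i \<inter> S j"
      using directed_setD(4)[OF I, of i k] directed_setD(4)[OF I, of j k] ij
      unfolding S_def by blast
    then show "\<exists>r\<in>J. le' p r \<and> le' q r"
      using ij k J_I by (intro bexI[of _ "(m k, S k)"]) (auto simp: le'_def)
  qed (auto simp: le'_def)
  have "fst ` J = m ` I"
  proof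
    show "fst ` J \<subseteq> m ` I"
      by (auto simp: J_def S_def)
    show "m ` I \<subseteq> fst ` J"
      using J_I by (metis fst_conv image_eqI image_subsetI)
  qed
  moreover have "filtermap fst (net_filter J le') = filtermap m (net_filter I le)"
  proof (rule filter_eqI)
    fix P
    have "eventually P (filtermap fst (net_filter J le')) \<longleftrightarrow> (\<exists>i\<in>I. \<forall>x\<in>S i. P x)"
    proof
      assume "eventually P (filtermap fst (net_filter J le'))"
      then obtain p where p: "p \<in> J" "\<And>q. q \<in> J \<Longrightarrow> le' p q \<Longrightarrow> P (fst q)"
        unfolding eventually_filtermap eventually_net_filter[OF J] by blast
      then obtain i where i: "i \<in> I" "snd p = S i"
        by (auto simp: J_def)
      have "P x" if "x \<in> S i" for x
        using p(2)[of "(x, S i)"] i that by (auto simp: J_def le'_def)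
      then show "\<exists>i\<in>I. \<forall>x\<in>S i. P x"
        using i by blast
    next
      assume "\<exists>i\<in>I. \<forall>x\<in>S i. P x"
      then obtain i where i: "i \<in> I" "\<forall>x\<in>S i. P x"
        by blast
      have "P (fst q)" if "q \<in> J" "le' (m i, S i) q" for q
        using that i by (auto simp: J_def le'_def)
      then show "eventually P (filtermap fst (net_filter J le'))"
        using J_I[OF i(1)] unfolding eventually_filtermap eventually_net_filter[OF J] by blast
    qed
    also have "\<dots> \<longleftrightarrow> eventually P (filtermap m (net_filter I le))"
      by (auto simp: eventually_filtermap eventually_net_filter[OF I] S_def)
    finally show "eventually P (filtermap fst (net_filter J le'))
        \<longleftrightarrow> eventually P (filtermap m (net_filter I le))" .
  qed
  ultimately show ?thesis
    using J by blast
qed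


section \<open>Pseudo-contractibility and strong pseudo-amenability\<close>

definition pseudo_contractible :: "'a::complex_banach_algebra itself \<Rightarrow> bool" where
  "pseudo_contractible (_ :: 'a itself) \<longleftrightarrow>
     (\<exists>(I :: ('a, 'a) ptensor net_index set) le (m :: _ \<Rightarrow> ('a, 'a) ptensor).
        directed_set I le \<and>
        (\<forall>a. \<forall>i\<in>I. tensor_left a (m i) = tensor_right (m i) a) \<and>
        (\<forall>a. ((\<lambda>i. product_map (m i) * a) \<longlongrightarrow> a) (net_filter I le)))"

definition product_map_bidual ::
  "('a::complex_banach_algebra, 'a) ptensor cdual cdual \<Rightarrow> 'a cdual cdual" where
  "product_map_bidual = adjoint_map (adjoint_map product_map)"

definition strong_pseudo_amenable :: "'a::complex_banach_algebra itself \<Rightarrow> bool" where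
  "strong_pseudo_amenable (_ :: 'a itself) \<longleftrightarrow>
     (\<exists>(I :: ('a, 'a) ptensor cdual cdual net_index set) le
        (m :: _ \<Rightarrow> ('a, 'a) ptensor cdual cdual).
        directed_set I le \<and>
        (\<forall>a. ((\<lambda>i. bidual_left tensor_left a (m i) - bidual_right tensor_right (m i) a) \<longlongrightarrow> 0)
               (net_filter I le)) \<and>
        (\<forall>a. \<forall>i\<in>I. bidual_left (*) a (product_map_bidual (m i))
                     = bidual_right (*) (product_map_bidual (m i)) a) \<and>
        (\<forall>a. ((\<lambda>i. bidual_right (*) (product_map_bidual (m i)) a) \<longlongrightarrow> canonical_embedding a)
               (net_filter I le)))"

end

theory Submission
  imports Defs
begin

text \<open>
  The canonical embedding \<open>X \<rightarrow> X\<^sup>*\<^sup>*\<close> is a contractive bimodule map, natural in \<open>X\<close>, so it carries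
  a net witnessing pseudo-contractibility to one witnessing strong pseudo-amenability.
\<close>

text \<open>The bound 1 is \<open>norm_cdual_apply\<close> read with \<open>x\<close> fixed and the
  functional varying. Continuity is what later carries norm limits into the bidual.\<close>

lemma bounded_clinear_canonical_embedding: "bounded_clinear canonical_embedding"
proof -
  note F = bounded_clinear_cdual_apply[unfolded bounded_clinear_def scaleC_complex_def]
  have add: "cdual_apply f (x + y) = cdual_apply f x + cdual_apply f y"
    and scaleR: "cdual_apply f (r *\<^sub>R x) = r *\<^sub>R cdual_apply f x"
    and scaleC: "cdual_apply f (c *\<^sub>C x) = c * cdual_apply f x"
    for f :: "'a cdual" and x y r c
    using F[of f] by (simp_all add: bounded_linear.linear linear_add linear_scale)
  have "norm (canonical_embedding x) \<le> norm x * 1" for x :: 'a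
    by (rule norm_cdual_bound)
      (use norm_cdual_apply in \<open>auto simp: canonical_embedding_apply mult.commute\<close>)
  then have "bounded_linear (canonical_embedding :: 'a \<Rightarrow> _)"
    by (intro bounded_linear_intro[of _ 1])
      (auto intro!: cdual_eqI simp: canonical_embedding_apply cdual_apply_simps add scaleR)
  then show ?thesis
    by (auto intro!: cdual_eqI
        simp: bounded_clinear_def canonical_embedding_apply cdual_apply_simps scaleC)
qed

text \<open>Each dualization moves the action to the other side, so two of them restore it:
  evaluated at a functional \<open>f\<close>, both sides give \<open>f\<close> at
  \<open>l a x\<close>.\<close>

lemma bidual_left_canonical_embedding:
  assumes "bounded_cbilinear l"
  shows "bidual_left l a (canonical_embedding x) = canonical_embedding (l a x)"
  using assms by (intro cdual_eqI)
    (simp add: dual_left_apply dual_right_apply bounded_cbilinear_dual_right canonical_embedding_apply)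

lemma bidual_right_canonical_embedding:
  assumes "bounded_cbilinear r"
  shows "bidual_right r (canonical_embedding x) a = canonical_embedding (r x a)"
  using assms by (intro cdual_eqI)
    (simp add: dual_left_apply dual_right_apply bounded_cbilinear_dual_left canonical_embedding_apply)

lemma biadjoint_canonical_embedding:
  assumes "bounded_clinear T"
  shows "adjoint_map (adjoint_map T) (canonical_embedding x) = canonical_embedding (T x)"
  using assms by (intro cdual_eqI)
    (simp add: adjoint_map_apply bounded_clinear_adjoint_map canonical_embedding_apply)

text \<open>Both sides are bounded linear in \<open>x\<close> and agree on elementary tensors by
  associativity.\<close>

lemma product_map_tensor_left: "product_map (tensor_left a x) = a * product_map x"
  by (rule ptensor_clinear_eqI)
    (auto intro!: bounded_clinear_compose[OF bounded_clinear_product_map]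
      bounded_clinear_compose[OF bounded_cbilinear_right[OF bounded_cbilinear_mult]]
      bounded_clinear_tensor_left bounded_clinear_product_map simp: mult.assoc)

lemma product_map_tensor_right: "product_map (tensor_right x a) = product_map x * a"
  by (rule ptensor_clinear_eqI)
    (auto intro!: bounded_clinear_compose[OF bounded_clinear_product_map]
      bounded_clinear_compose[OF bounded_cbilinear_left[OF bounded_cbilinear_mult]]
      bounded_clinear_tensor_right bounded_clinear_product_map simp: mult.assoc)

text \<open>The definition fixes one index type; \<open>net_reindex\<close> allows a witness indexed
  by any type, such as the one inherited from pseudo-contractibility.\<close>

lemma strong_pseudo_amenableI:
  fixes m :: "'i \<Rightarrow> ('a::complex_banach_algebra, 'a) ptensor cdual cdual"
  assumes I: "directed_set I le"
    and comm: "\<And>a. ((\<lambda>i. bidual_left tensor_left a (m i) - bidual_right tensor_right (m i) a) \<longlongrightarrow> 0)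
                 (net_filter I le)"
    and central: "\<And>a i. i \<in> I \<Longrightarrow> bidual_left (*) a (product_map_bidual (m i))
                 = bidual_right (*) (product_map_bidual (m i)) a"
    and unit: "\<And>a. ((\<lambda>i. bidual_right (*) (product_map_bidual (m i)) a) \<longlongrightarrow> canonical_embedding a)
                 (net_filter I le)"
  shows "strong_pseudo_amenable TYPE('a)"
proof -
  obtain J :: "('a, 'a) ptensor cdual cdual net_index set" and le' n
    where J: "directed_set J le'" and img: "n ` J = m ` I"
      and filt: "filtermap n (net_filter J le') = filtermap m (net_filter I le)"
    using net_reindex[OF I, of m] by blast
  \<comment> \<open>Convergence of \<open>g\<close> along a net depends only on the image filter of
    the net.\<close>
  have lim: "((\<lambda>j. g (n j)) \<longlongrightarrow> L) (net_filter J le')"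
    if "((\<lambda>i. g (m i)) \<longlongrightarrow> L) (net_filter I le)" for g and L :: "'b::topological_space"
    using that filt by (simp add: filterlim_def flip: filtermap_filtermap)
  \<comment> \<open>This identity is required at every index, so it is transferred through the
    equality of the ranges.\<close>
  have "bidual_left (*) a (product_map_bidual (n j)) = bidual_right (*) (product_map_bidual (n j)) a"
    if "j \<in> J" for a j
    using that img central by (metis imageE imageI)
  then show ?thesis
    unfolding strong_pseudo_amenable_def using J lim[OF comm] lim[OF unit] by blast
qed

theorem lemma2p3:
  assumes "pseudo_contractible TYPE('a::complex_banach_algebra)"
  shows "strong_pseudo_amenable TYPE('a)"
proof -
  obtain I :: "('a, 'a) ptensor net_index set" and le and m :: "_ \<Rightarrow> ('a, 'a) ptensor"
    where I: "directed_set I le"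
      and central: "\<And>a i. i \<in> I \<Longrightarrow> tensor_left a (m i) = tensor_right (m i) a"
      and unit: "\<And>a. ((\<lambda>i. product_map (m i) * a) \<longlongrightarrow> a) (net_filter I le)"
    using assms unfolding pseudo_contractible_def by blast
  note embed = bidual_left_canonical_embedding[OF bounded_cbilinear_tensor_left]
    bidual_right_canonical_embedding[OF bounded_cbilinear_tensor_right]
    bidual_left_canonical_embedding[OF bounded_cbilinear_mult]
    bidual_right_canonical_embedding[OF bounded_cbilinear_mult]
    biadjoint_canonical_embedding[OF bounded_clinear_product_map, folded product_map_bidual_def]
  \<comment> \<open>\<open>central\<close> speaks only of indices in \<open>I\<close>; every tail
    lies in \<open>I\<close>.\<close>
  have ev: "\<forall>\<^sub>F i in net_filter I le. i \<in> I"
    using directed_setD(1)[OF I] by (auto simp: eventually_net_filter[OF I])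
  show ?thesis
  proof (rule strong_pseudo_amenableI[OF I, of "\<lambda>i. canonical_embedding (m i)"])
    fix a :: 'a
    show "((\<lambda>i. bidual_left tensor_left a (canonical_embedding (m i))
        - bidual_right tensor_right (canonical_embedding (m i)) a) \<longlongrightarrow> 0) (net_filter I le)"
      \<comment> \<open>Both terms are the image of the same tensor, so the difference is eventually
        equal to 0.\<close>
      by (rule tendsto_eventually, rule eventually_mono[OF ev]) (simp add: embed central)
    have "((\<lambda>i. canonical_embedding (product_map (m i) * a)) \<longlongrightarrow> canonical_embedding a)
        (net_filter I le)"
      using bounded_clinear_canonical_embedding unit
      by (auto simp: bounded_clinear_def intro: bounded_linear.tendsto)
    then show "((\<lambda>i. bidual_right (*) (product_map_bidual (canonical_embedding (m i))) a)
        \<longlongrightarrow> canonical_embedding a) (net_filter I le)"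
      by (simp add: embed)
    fix i assume "i \<in> I"
    \<comment> \<open>Apply \<open>product_map\<close> to both sides of
      \<open>central\<close>.\<close>
    then have "a * product_map (m i) = product_map (m i) * a"
      using central by (metis product_map_tensor_left product_map_tensor_right)
    then show "bidual_left (*) a (product_map_bidual (canonical_embedding (m i)))
        = bidual_right (*) (product_map_bidual (canonical_embedding (m i))) a"
      by (simp add: embed)
  qed
qed

end
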